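(* Let $g_1:[x_0,x_1]\to\mathbb{R}$ and $g_2:[x_0',x_1']\to\mathbb{R}$ be two strictly concave continuous functions, each differentiable except at the right endpoint of its interval, with $g_1'(x_0)=0$, $g_2'(x_0')=0$, and with vertical tangent line at the right endpoint ($g_1'(x_1^-)=-\infty$, $g_2'(x_1'^-)=-\infty$). Let $\gamma_{a,b}$ and $\delta_{a,b}$ be the coefficients of the supporting lines $ax+by=\gamma_{a,b}$ and $ax+by=\delta_{a,b}$ for the graphs of $g_1$ and $g_2$, respectively. Then $$\sum_{\substack{a,b,c,d\in\mathbb{Z}_{\ge0}\\ ad-bc=1}}(\gamma_{a,b}+\gamma_{c,d}-\gamma_{a+c,b+d})(\delta_{a,b}+\delta_{c,d}-\delta_{a+c,b+d})$$ is equal to the mixed area of the $g_1$-triangle and the $g_2$-triangle.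
   Context: For a function $g:[x_0,x_1]\to\mathbb{R}$ that is strictly concave and continuous on $[x_0,x_1]$, differentiable on $[x_0,x_1)$, with $g'(x_0)=0$ and $g'(x_1^-)=-\infty$, the $g$-triangle is the curvilinear triangle with vertices $(x_0,g(x_0))$, $(x_1,g(x_0))$, $(x_1,g(x_1))$, where $(x_0,g(x_0))$ and $(x_1,g(x_1))$ are connected by the graph of $g$ and the two other sides are a horizontal and a vertical straight segment. For a primitive vector $(a,b)\in\mathbb{Z}_{\ge0}^2$, the supporting line of the graph of $g$ orthogonal to $(a,b)$ is the line $ax+by=\gamma_{a,b}$ that touches the graph, the graph lying in the half-plane $ax+by\le\gamma_{a,b}$. The mixed area of the $g_1$-triangle and the $g_2$-triangle is taken to be the coefficient of $\epsilon$ (with no factor $1/2$) in $\mathrm{Area}(X)$, where $X$ denotes the Minkowski sum of the $g_1$-triangle and the $g_2$-triangle scaled by $\epsilon$; here $X$ is regarded as again a $g$-triangle for some function $g$, whose supporting-line coefficient in direction $(a,b)$ is $\gamma_{a,b}+\epsilon\delta_{a,b}$. *)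

theory Defs
  imports "HOL-Analysis.Analysis" "HOL-Computational_Algebra.Polynomial"
begin

definition strictly_concave_on :: "real set \<Rightarrow> (real \<Rightarrow> real) \<Rightarrow> bool" where
  "strictly_concave_on S g \<longleftrightarrow> convex S \<and>
     (\<forall>x\<in>S. \<forall>y\<in>S. \<forall>t. x \<noteq> y \<and> 0 < t \<and> t < 1 \<longrightarrow>
        (1 - t) * g x + t * g y < g ((1 - t) * x + t * y))"

definition triangle_function :: "real \<Rightarrow> real \<Rightarrow> (real \<Rightarrow> real) \<Rightarrow> bool" where
  "triangle_function x0 x1 g \<longleftrightarrow>
     x0 < x1 \<and>
     strictly_concave_on {x0..x1} g \<and>
     continuous_on {x0..x1} g \<and>
     (\<forall>x\<in>{x0..<x1}. g differentiable (at x within {x0..x1})) \<and>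
     (g has_real_derivative 0) (at x0 within {x0..x1}) \<and>
     filterlim (deriv g) at_bot (at_left x1)"

text \<open>The corner \<open>(x1, g x0)\<close> lies above the graph of the (decreasing) function \<open>g\<close>, so the
  curvilinear triangle is the region between the graph and the horizontal line \<open>y = g x0\<close>.\<close>

definition g_triangle :: "real \<Rightarrow> real \<Rightarrow> (real \<Rightarrow> real) \<Rightarrow> (real \<times> real) set" where
  "g_triangle x0 x1 g = {(x, y). x0 \<le> x \<and> x \<le> x1 \<and> g x \<le> y \<and> y \<le> g x0}"

definition supporting_line ::
    "real \<Rightarrow> real \<Rightarrow> (real \<Rightarrow> real) \<Rightarrow> nat \<Rightarrow> nat \<Rightarrow> real \<Rightarrow> bool" where
  "supporting_line x0 x1 g a b \<gamma> \<longleftrightarrow>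
     (\<forall>x\<in>{x0..x1}. real a * x + real b * g x \<le> \<gamma>) \<and>
     (\<exists>x\<in>{x0..x1}. real a * x + real b * g x = \<gamma>)"

definition subgraph :: "real \<Rightarrow> real \<Rightarrow> (real \<Rightarrow> real) \<Rightarrow> (real \<times> real) set" where
  "subgraph x0 x1 g = {(x, y). x0 \<le> x \<and> x \<le> x1 \<and> y \<le> g x}"

text \<open>The sum of the \<open>g1\<close>-triangle and of the \<open>g2\<close>-triangle scaled by \<open>\<epsilon>\<close>.
  A \<open>g\<close>-triangle lies on the non-convex side of its curved edge, and the pointwise sum of two
  such sets is not of the same form. The Minkowski sum is therefore taken on the convex side:
  the sum is the \<open>g\<close>-triangle for which the region below the graph of \<open>g\<close> is the Minkowski sum of
  the regions below the graphs of \<open>g1\<close> and (scaled by \<open>\<epsilon>\<close>) of \<open>g2\<close>.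
  The coefficients of the supporting lines then add up as \<open>\<gamma> + \<epsilon> * \<delta>\<close>;
  see \<open>triangle_sum_supporting_line\<close> below.\<close>

definition triangle_sum ::
    "real \<Rightarrow> real \<Rightarrow> (real \<Rightarrow> real) \<Rightarrow> real \<Rightarrow> real \<Rightarrow> (real \<Rightarrow> real) \<Rightarrow> real \<Rightarrow>
     real \<Rightarrow> real \<Rightarrow> (real \<Rightarrow> real) \<Rightarrow> bool" where
  "triangle_sum x0 x1 g1 x0' x1' g2 \<epsilon> y0 y1 g \<longleftrightarrow>
     triangle_function y0 y1 g \<and>
     subgraph y0 y1 g =
       {p + \<epsilon> *\<^sub>R q | p q. p \<in> subgraph x0 x1 g1 \<and> q \<in> subgraph x0' x1' g2}"

text \<open>The coefficient of \<open>\<epsilon>\<close> in the area of the sum, without the factor \<open>1/2\<close>. The sum is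
  unique by \<open>triangle_sum_unique\<close>, and a polynomial is determined by its values at \<open>\<epsilon> > 0\<close>.\<close>

definition has_mixed_area ::
    "real \<Rightarrow> real \<Rightarrow> (real \<Rightarrow> real) \<Rightarrow> real \<Rightarrow> real \<Rightarrow> (real \<Rightarrow> real) \<Rightarrow> real \<Rightarrow> bool" where
  "has_mixed_area x0 x1 g1 x0' x1' g2 M \<longleftrightarrow>
     (\<exists>p :: real poly.
        (\<forall>\<epsilon>>0. \<exists>y0 y1 g. triangle_sum x0 x1 g1 x0' x1' g2 \<epsilon> y0 y1 g \<and>
           measure lborel (g_triangle y0 y1 g) = poly p \<epsilon>) \<and>
        coeff p 1 = M)"

lemma triangle_sum_supporting_line:
  assumes sum: "triangle_sum x0 x1 g1 x0' x1' g2 \<epsilon> y0 y1 g" and "\<epsilon> > 0"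
    and s1: "supporting_line x0 x1 g1 a b \<gamma>" and s2: "supporting_line x0' x1' g2 a b \<delta>"
  shows "supporting_line y0 y1 g a b (\<gamma> + \<epsilon> * \<delta>)"
proof -
  have eq: "subgraph y0 y1 g =
      {p + \<epsilon> *\<^sub>R q | p q. p \<in> subgraph x0 x1 g1 \<and> q \<in> subgraph x0' x1' g2}"
    using sum by (simp add: triangle_sum_def)
  have le: "real a * z + real b * g z \<le> \<gamma> + \<epsilon> * \<delta>" if "z \<in> {y0..y1}" for z
  proof -
    have "(z, g z) \<in> subgraph y0 y1 g" using that by (simp add: subgraph_def)
    then obtain u v u' v' where uv: "(u, v) \<in> subgraph x0 x1 g1" "(u', v') \<in> subgraph x0' x1' g2"
      and z: "z = u + \<epsilon> * u'" "g z = v + \<epsilon> * v'"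
      unfolding eq by auto
    have "real a * u + real b * v \<le> real a * u + real b * g1 u"
      using uv by (auto simp: subgraph_def intro: mult_left_mono)
    also have "\<dots> \<le> \<gamma>" using s1 uv by (auto simp: subgraph_def supporting_line_def)
    finally have 1: "real a * u + real b * v \<le> \<gamma>" .
    have "real a * u' + real b * v' \<le> real a * u' + real b * g2 u'"
      using uv by (auto simp: subgraph_def intro: mult_left_mono)
    also have "\<dots> \<le> \<delta>" using s2 uv by (auto simp: subgraph_def supporting_line_def)
    finally have "\<epsilon> * (real a * u' + real b * v') \<le> \<epsilon> * \<delta>"
      using \<open>\<epsilon> > 0\<close> by simp
    with 1 show ?thesis unfolding z(2) by (simp add: z(1) algebra_simps)
  qed
  obtain u where u: "u \<in> {x0..x1}" "real a * u + real b * g1 u = \<gamma>"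
    using s1 by (auto simp: supporting_line_def)
  obtain u' where u': "u' \<in> {x0'..x1'}" "real a * u' + real b * g2 u' = \<delta>"
    using s2 by (auto simp: supporting_line_def)
  have "(u, g1 u) + \<epsilon> *\<^sub>R (u', g2 u') \<in> subgraph y0 y1 g"
    unfolding eq using u u' by (force simp: subgraph_def)
  then have z: "u + \<epsilon> * u' \<in> {y0..y1}" "g1 u + \<epsilon> * g2 u' \<le> g (u + \<epsilon> * u')"
    by (auto simp: subgraph_def)
  have "\<gamma> + \<epsilon> * \<delta> = real a * (u + \<epsilon> * u') + real b * (g1 u + \<epsilon> * g2 u')"
    by (simp add: u(2)[symmetric] u'(2)[symmetric] algebra_simps)
  also have "\<dots> \<le> real a * (u + \<epsilon> * u') + real b * g (u + \<epsilon> * u')"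
    using z(2) by (simp add: mult_left_mono)
  finally show ?thesis
    using le z(1) unfolding supporting_line_def by (meson order_antisym)
qed

lemma triangle_sum_unique:
  assumes "triangle_sum x0 x1 g1 x0' x1' g2 \<epsilon> y0 y1 g"
    and "triangle_sum x0 x1 g1 x0' x1' g2 \<epsilon> z0 z1 h"
  shows "g_triangle y0 y1 g = g_triangle z0 z1 h"
proof -
  have eq: "subgraph y0 y1 g = subgraph z0 z1 h" and "y0 < y1" "z0 < z1"
    using assms by (auto simp: triangle_sum_def triangle_function_def)
  have fst_subgraph: "fst ` subgraph u v f = {u..v}" for u v f
    by (force simp: subgraph_def)
  have "{y0..y1} = {z0..z1}"
    using eq fst_subgraph by metis
  then have ends: "y0 = z0" "y1 = z1"
    using \<open>y0 < y1\<close> \<open>z0 < z1\<close> by (auto simp: Icc_eq_Icc)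
  have "g x = h x" if "x \<in> {y0..y1}" for x
  proof (rule antisym)
    have "(x, g x) \<in> subgraph y0 y1 g" using that by (simp add: subgraph_def)
    then have "(x, g x) \<in> subgraph z0 z1 h" by (simp add: eq)
    then show "g x \<le> h x" by (simp add: subgraph_def)
    have "(x, h x) \<in> subgraph z0 z1 h" using that ends by (simp add: subgraph_def)
    then have "(x, h x) \<in> subgraph y0 y1 g" by (simp add: eq)
    then show "h x \<le> g x" by (simp add: subgraph_def)
  qed
  then show ?thesis
    using ends \<open>y0 < y1\<close> by (auto simp: g_triangle_def)
qed

end

theory Submission
  imports Defs
begin

text \<open>Twice the area of a \<open>g\<close>-triangle is the sum of the squares of
  \<open>\<gamma> a b + \<gamma> c d - \<gamma> (a + c) (b + d)\<close> over all unimodular pairs \<open>(a, b), (c, d)\<close>. Starting from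
  the corner bounded by the horizontal and the vertical side, cut corners repeatedly: the supporting line
  orthogonal to \<open>(a + c, b + d)\<close> cuts off from the corner formed by the supporting lines
  orthogonal to \<open>(a, b)\<close> and \<open>(c, d)\<close> a triangle which is unimodularly equivalent to a right
  isosceles triangle with legs \<open>\<gamma> a b + \<gamma> c d - \<gamma> (a + c) (b + d)\<close>. These triangles are
  disjoint and exhaust the \<open>g\<close>-triangle up to a null set. Applied to the sum of the
  \<open>g1\<close>-triangle and the \<open>\<epsilon>\<close>-scaled \<open>g2\<close>-triangle, whose coefficients are \<open>\<gamma> + \<epsilon> * \<delta>\<close>, this gives
  an area that is quadratic in \<open>\<epsilon>\<close> with the claimed linear coefficient. That the sum is again
  a \<open>g\<close>-triangle holds because it is bounded by the sup-convolution of \<open>g1\<close> and the scaled \<open>g2\<close>,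
  whose derivative at \<open>z\<close> is the common derivative at the two points of the optimal
  decomposition of \<open>z\<close>.\<close>

section \<open>Triangle functions\<close>

lemma strictly_concave_onD:
  assumes "strictly_concave_on S g" "x \<in> S" "y \<in> S" "x \<noteq> y" "0 < t" "t < 1"
  shows "(1 - t) * g x + t * g y < g ((1 - t) * x + t * y)"
  using assms by (auto simp: strictly_concave_on_def)

lemma strictly_concave_on_weak:
  assumes "strictly_concave_on S g" "x \<in> S" "y \<in> S" "0 \<le> t" "t \<le> 1"
  shows "(1 - t) * g x + t * g y \<le> g ((1 - t) * x + t * y)"
proof (cases "x = y \<or> t = 0 \<or> t = 1")
  case True
  then show ?thesis by (auto simp: algebra_simps)
next
  case False
  then show ?thesis
    using assms by (intro less_imp_le strictly_concave_onD) auto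
qed

text \<open>Concavity along the segment from \<open>u\<close> to \<open>x\<close> keeps every
  difference quotient in \<open>t\<close> above \<open>g x - g u\<close>, and its limit at 0 is
  \<open>m * (x - u)\<close>. The derivative is taken within \<open>S\<close>, so endpoints of an
  interval are covered.\<close>

lemma strictly_concave_on_below_tangent:
  assumes g: "strictly_concave_on S g" and "u \<in> S" "x \<in> S"
    and D: "(g has_real_derivative m) (at u within S)"
  shows "g x \<le> g u + m * (x - u)"
proof -
  let ?l = "\<lambda>t. (1 - t) * u + t * x"
  have "?l ` {0..1} \<subseteq> S"
    using g \<open>u \<in> S\<close> \<open>x \<in> S\<close> by (auto simp: strictly_concave_on_def convex_alt)
  then have "(g has_real_derivative m) (at (?l 0) within ?l ` {0..1})"
    using D by (auto intro: DERIV_subset)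
  moreover have "(?l has_real_derivative x - u) (at 0 within {0..1})"
    by (auto intro!: derivative_eq_intros)
  ultimately have "((g \<circ> ?l) has_real_derivative m * (x - u)) (at 0 within {0..1})"
    by (rule DERIV_image_chain)
  then have lim: "((\<lambda>t. (g (?l t) - g u) / t) \<longlongrightarrow> m * (x - u)) (at 0 within {0..1})"
    by (simp add: has_field_derivative_iff)
  have "\<forall>\<^sub>F t in at 0 within {0..1::real}. g x - g u \<le> (g (?l t) - g u) / t"
  proof (unfold eventually_at_filter, intro always_eventually allI impI)
    fix t :: real assume "t \<noteq> 0" "t \<in> {0..1}"
    then show "g x - g u \<le> (g (?l t) - g u) / t"
      using strictly_concave_on_weak[OF g \<open>u \<in> S\<close> \<open>x \<in> S\<close>, of t]
      by (simp add: field_simps)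
  qed
  moreover have "at 0 within {0..1::real} \<noteq> bot"
    by (simp add: trivial_limit_within islimpt_Icc)
  ultimately have "g x - g u \<le> m * (x - u)"
    using lim by (intro tendsto_lowerbound) auto
  then show ?thesis by simp
qed

text \<open>Trades \<open>deriv\<close> for an explicit derivative \<open>D\<close>, one-sided at
  \<open>x0\<close>. The two agree on the open interval, so the limit at \<open>x1\<close> is
  unaffected.\<close>

lemma triangle_function_iff:
  "triangle_function x0 x1 g \<longleftrightarrow>
     x0 < x1 \<and> strictly_concave_on {x0..x1} g \<and> continuous_on {x0..x1} g \<and>
     (\<exists>D. (\<forall>x\<in>{x0..<x1}. (g has_real_derivative D x) (at x within {x0..x1})) \<and> D x0 = 0 \<and>
        filterlim D at_bot (at_left x1))"
    (is "_ \<longleftrightarrow> _ \<and> _ \<and> _ \<and> (\<exists>D. ?P D)")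
proof (cases "x0 < x1")
  case lt: True
  have deriv_eq: "deriv g x = D x"
    if "(g has_real_derivative D x) (at x within {x0..x1})" "x0 < x" "x < x1" for x D
    using that by (simp add: at_within_Icc_at DERIV_imp_deriv)
  have ev: "\<forall>\<^sub>F x in at_left x1. x0 < x \<and> x < x1"
    using lt by (auto simp: eventually_at_left)
  have cong: "filterlim (deriv g) at_bot (at_left x1) \<longleftrightarrow> filterlim D at_bot (at_left x1)"
    if "\<forall>x\<in>{x0..<x1}. (g has_real_derivative D x) (at x within {x0..x1})" for D
    by (rule filterlim_cong) (use that deriv_eq in \<open>auto intro!: eventually_mono[OF ev]\<close>)
  have "(\<exists>D. ?P D) \<longleftrightarrow>
     (\<forall>x\<in>{x0..<x1}. g differentiable (at x within {x0..x1})) \<and>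
     (g has_real_derivative 0) (at x0 within {x0..x1}) \<and> filterlim (deriv g) at_bot (at_left x1)"
    (is "_ \<longleftrightarrow> ?d \<and> ?z \<and> ?f")
  proof
    assume "\<exists>D. ?P D"
    then obtain D where D: "?P D" by blast
    then have ?z using lt by (metis atLeastLessThan_iff order_refl)
    moreover have ?d using D by (auto simp: real_differentiable_def)
    ultimately show "?d \<and> ?z \<and> ?f" using D cong by blast
  next
    assume r: "?d \<and> ?z \<and> ?f"
    then obtain E where E: "\<forall>x\<in>{x0..<x1}. (g has_real_derivative E x) (at x within {x0..x1})"
      by (metis real_differentiable_def)
    then have "\<forall>x\<in>{x0..<x1}. (g has_real_derivative (E(x0 := 0)) x) (at x within {x0..x1})"
      using r by auto
    then show "\<exists>D. ?P D" using cong r by (intro exI[of _ "E(x0 := 0)"]) auto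
  qed
  then show ?thesis using lt by (auto simp: triangle_function_def)
qed (simp add: triangle_function_def)

lemma triangle_function_le_left:
  assumes "triangle_function x0 x1 g" "x \<in> {x0..x1}"
  shows "g x \<le> g x0"
  using assms strictly_concave_on_below_tangent[of "{x0..x1}" g x0 x 0]
  by (auto simp: triangle_function_def)

lemma triangle_function_less_left:
  assumes tf: "triangle_function x0 x1 g" and x: "x \<in> {x0<..x1}"
  shows "g x < g x0"
proof (rule ccontr)
  assume "\<not> g x < g x0"
  moreover have "(1 - 1/2) * g x0 + 1/2 * g x < g ((1 - 1/2) * x0 + 1/2 * x)"
    using assms by (intro strictly_concave_onD[of "{x0..x1}"]) (auto simp: triangle_function_def)
  moreover have "g ((1 - 1/2) * x0 + 1/2 * x) \<le> g x0"
    using x by (intro triangle_function_le_left[OF tf]) auto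
  ultimately show False by simp
qed

text \<open>The new graph is the old one dilated by \<open>\<epsilon>\<close>, which reduces the sum
  \<open>p + \<epsilon> *\<^sub>R q\<close> to an unscaled one.\<close>

lemma triangle_function_scale:
  assumes tf: "triangle_function x0 x1 g" and e: "\<epsilon> > 0"
  shows "triangle_function (\<epsilon> * x0) (\<epsilon> * x1) (\<lambda>x. \<epsilon> * g (x / \<epsilon>))"
proof -
  obtain D where g: "x0 < x1" "strictly_concave_on {x0..x1} g" "continuous_on {x0..x1} g"
    and D: "\<And>x. x \<in> {x0..<x1} \<Longrightarrow> (g has_real_derivative D x) (at x within {x0..x1})"
    "D x0 = 0" "filterlim D at_bot (at_left x1)"
    using tf unfolding triangle_function_iff by blast
  have img: "(\<lambda>x. x / \<epsilon>) ` {\<epsilon> * x0..\<epsilon> * x1} \<subseteq> {x0..x1}"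
    using e by (auto simp: field_simps)
  show ?thesis unfolding triangle_function_iff
  proof (intro conjI exI[of _ "\<lambda>x. D (x / \<epsilon>)"] ballI)
    show "\<epsilon> * x0 < \<epsilon> * x1" using g e by simp
    show "strictly_concave_on {\<epsilon> * x0..\<epsilon> * x1} (\<lambda>x. \<epsilon> * g (x / \<epsilon>))"
      unfolding strictly_concave_on_def
    proof (intro conjI ballI allI impI)
      fix x y t :: real assume xy: "x \<in> {\<epsilon> * x0..\<epsilon> * x1}" "y \<in> {\<epsilon> * x0..\<epsilon> * x1}"
        and t: "x \<noteq> y \<and> 0 < t \<and> t < 1"
      have "(1 - t) * g (x / \<epsilon>) + t * g (y / \<epsilon>) < g ((1 - t) * (x / \<epsilon>) + t * (y / \<epsilon>))"
        using xy t img e by (intro strictly_concave_onD[OF g(2)]) (auto simp: field_simps)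
      also have "(1 - t) * (x / \<epsilon>) + t * (y / \<epsilon>) = ((1 - t) * x + t * y) / \<epsilon>"
        by (simp add: add_divide_distrib)
      finally have "\<epsilon> * ((1 - t) * g (x / \<epsilon>) + t * g (y / \<epsilon>)) < \<epsilon> * g (((1 - t) * x + t * y) / \<epsilon>)"
        using e by simp
      then show "(1 - t) * (\<epsilon> * g (x / \<epsilon>)) + t * (\<epsilon> * g (y / \<epsilon>)) < \<epsilon> * g (((1 - t) * x + t * y) / \<epsilon>)"
        by (simp add: algebra_simps)
    qed simp
    show "continuous_on {\<epsilon> * x0..\<epsilon> * x1} (\<lambda>x. \<epsilon> * g (x / \<epsilon>))"
      using img e by (intro continuous_intros continuous_on_compose2[OF g(3)]) auto
    show "D (\<epsilon> * x0 / \<epsilon>) = 0" using e D by simp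
    show "((\<lambda>x. \<epsilon> * g (x / \<epsilon>)) has_real_derivative D (x / \<epsilon>)) (at x within {\<epsilon> * x0..\<epsilon> * x1})"
      if "x \<in> {\<epsilon> * x0..<\<epsilon> * x1}" for x
    proof -
      have "x / \<epsilon> \<in> {x0..<x1}" using that e by (auto simp: field_simps)
      then have "(g has_real_derivative D (x / \<epsilon>)) (at (x / \<epsilon>) within (\<lambda>x. x / \<epsilon>) ` {\<epsilon> * x0..\<epsilon> * x1})"
        using img by (blast intro: DERIV_subset D)
      moreover have "((\<lambda>x. x / \<epsilon>) has_real_derivative 1 / \<epsilon>) (at x within {\<epsilon> * x0..\<epsilon> * x1})"
        using e by (auto intro!: derivative_eq_intros)
      ultimately have "((g \<circ> (\<lambda>x. x / \<epsilon>)) has_real_derivative D (x / \<epsilon>) * (1 / \<epsilon>))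
          (at x within {\<epsilon> * x0..\<epsilon> * x1})"
        by (rule DERIV_image_chain)
      from DERIV_cmult[OF this, of \<epsilon>] show ?thesis using e by (simp add: o_def)
    qed
    have "filterlim (\<lambda>x. x / \<epsilon>) (at_left x1) (at_left (\<epsilon> * x1))"
      unfolding filterlim_at
    proof
      show "\<forall>\<^sub>F x in at_left (\<epsilon> * x1). x / \<epsilon> \<in> {..<x1} \<and> x / \<epsilon> \<noteq> x1"
        using e by (auto simp: eventually_at_filter field_simps)
      have "((\<lambda>x. x / \<epsilon>) \<longlongrightarrow> (\<epsilon> * x1) / \<epsilon>) (at_left (\<epsilon> * x1))"
        using e by (intro tendsto_intros) auto
      then show "((\<lambda>x. x / \<epsilon>) \<longlongrightarrow> x1) (at_left (\<epsilon> * x1))" using e by simp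
    qed
    then show "filterlim (\<lambda>x. D (x / \<epsilon>)) at_bot (at_left (\<epsilon> * x1))"
      by (rule filterlim_compose[OF D(3)])
  qed
qed

lemma subgraph_scale:
  assumes e: "\<epsilon> > 0"
  shows "subgraph (\<epsilon> * x0) (\<epsilon> * x1) (\<lambda>x. \<epsilon> * g (x / \<epsilon>)) = (\<lambda>p. \<epsilon> *\<^sub>R p) ` subgraph x0 x1 g"
proof
  show "subgraph (\<epsilon> * x0) (\<epsilon> * x1) (\<lambda>x. \<epsilon> * g (x / \<epsilon>)) \<subseteq> (\<lambda>p. \<epsilon> *\<^sub>R p) ` subgraph x0 x1 g"
  proof
    fix p assume p: "p \<in> subgraph (\<epsilon> * x0) (\<epsilon> * x1) (\<lambda>x. \<epsilon> * g (x / \<epsilon>))"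
    have "p = \<epsilon> *\<^sub>R (fst p / \<epsilon>, snd p / \<epsilon>)" using e by (simp add: prod_eq_iff)
    moreover have "(fst p / \<epsilon>, snd p / \<epsilon>) \<in> subgraph x0 x1 g"
      using p e by (auto simp: subgraph_def field_simps)
    ultimately show "p \<in> (\<lambda>p. \<epsilon> *\<^sub>R p) ` subgraph x0 x1 g" by blast
  qed
qed (use e in \<open>auto simp: subgraph_def\<close>)


section \<open>Sup-convolution\<close>

text \<open>\<open>attained\<close> and \<open>upper\<close> together say that \<open>g z\<close> is
  the maximum of \<open>g1 u + g2 v\<close> over \<open>u + v = z\<close>. This form is symmetric in
  the two summands and independent of a choice of maximizer.\<close>

locale sup_convolution =
  fixes x0 x1 :: real and g1 :: "real \<Rightarrow> real" and x0' x1' :: real and g2 g :: "real \<Rightarrow> real"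
  assumes tf1: "triangle_function x0 x1 g1" and tf2: "triangle_function x0' x1' g2"
    and attained: "\<And>z. z \<in> {x0 + x0'..x1 + x1'} \<Longrightarrow>
      \<exists>u\<in>{x0..x1}. \<exists>v\<in>{x0'..x1'}. z = u + v \<and> g z = g1 u + g2 v"
    and upper: "\<And>u v. u \<in> {x0..x1} \<Longrightarrow> v \<in> {x0'..x1'} \<Longrightarrow> g1 u + g2 v \<le> g (u + v)"
begin

lemma commute: "sup_convolution x0' x1' g2 x0 x1 g1 g"
proof
  fix z assume "z \<in> {x0' + x0..x1' + x1}"
  then show "\<exists>u\<in>{x0'..x1'}. \<exists>v\<in>{x0..x1}. z = u + v \<and> g z = g2 u + g1 v"
    using attained[of z] by (metis add.commute)
next
  fix u v assume "u \<in> {x0'..x1'}" "v \<in> {x0..x1}"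
  then show "g2 u + g1 v \<le> g (u + v)" using upper[of v u] by (simp add: add.commute)
qed (use tf1 tf2 in auto)

text \<open>Moving \<open>u\<close> away from the vertical tangent at \<open>x1\<close> gains arbitrarily much per unit, while
  \<open>g2\<close> loses at most the slope of its chord from \<open>v\<close> to \<open>x1'\<close>.\<close>

lemma optimal_less_right:
  assumes u: "u \<in> {x0..x1}" and v: "v \<in> {x0'..<x1'}" and opt: "g (u + v) = g1 u + g2 v"
  shows "u < x1"
proof (rule ccontr)
  assume "\<not> u < x1"
  with u have [simp]: "u = x1" by simp
  obtain D where g1: "x0 < x1" "strictly_concave_on {x0..x1} g1"
    and D: "\<And>x. x \<in> {x0..<x1} \<Longrightarrow> (g1 has_real_derivative D x) (at x within {x0..x1})"
    "filterlim D at_bot (at_left x1)"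
    using tf1 unfolding triangle_function_iff by blast
  define K where "K = (g2 x1' - g2 v) / (x1' - v)"
  have "\<forall>\<^sub>F w in at_left x1. D w \<le> K - 1"
    using D(2) by (simp add: filterlim_at_bot)
  \<comment> \<open>These bounds keep \<open>w\<close> and the shifted point
    \<open>v + (x1 - w)\<close> inside the two domains.\<close>
  moreover have "\<forall>\<^sub>F w in at_left x1. max x0 (x1 - (x1' - v)) < w \<and> w < x1"
    using g1 v eventually_at_left_real[of "max x0 (x1 - (x1' - v))" x1] by simp
  ultimately have "\<forall>\<^sub>F w in at_left x1. D w \<le> K - 1 \<and> max x0 (x1 - (x1' - v)) < w \<and> w < x1"
    by (rule eventually_conj)
  then obtain w where w: "D w \<le> K - 1" "x0 < w" "x1 - (x1' - v) < w" "w < x1"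
    using eventually_happens'[OF trivial_limit_at_left_real] by force
  have "g1 x1 \<le> g1 w + D w * (x1 - w)"
    using g1 w D(1) by (intro strictly_concave_on_below_tangent[of "{x0..x1}"]) auto
  also have "\<dots> \<le> g1 w + (K - 1) * (x1 - w)"
    using w by (simp add: mult_right_mono)
  finally have 1: "g1 x1 \<le> g1 w + (K - 1) * (x1 - w)" .
  define t where "t = (x1 - w) / (x1' - v)"
  have t: "0 \<le> t" "t \<le> 1" using v w by (auto simp: t_def field_simps)
  have "(1 - t) * g2 v + t * g2 x1' \<le> g2 ((1 - t) * v + t * x1')"
    using tf2 v t by (intro strictly_concave_on_weak[of "{x0'..x1'}"]) (auto simp: triangle_function_def)
  also have "(1 - t) * v + t * x1' = v + t * (x1' - v)" by (simp add: algebra_simps)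
  also have "t * (x1' - v) = x1 - w" using v by (simp add: t_def)
  finally have "g2 v + t * (g2 x1' - g2 v) \<le> g2 (v + (x1 - w))" by (simp add: algebra_simps)
  moreover have "t * (g2 x1' - g2 v) = K * (x1 - w)" by (simp add: t_def K_def)
  ultimately have 2: "g2 v + K * (x1 - w) \<le> g2 (v + (x1 - w))" by simp
  have "g1 w + g2 (v + (x1 - w)) \<le> g (w + (v + (x1 - w)))"
    using w v by (intro upper) auto
  also have "\<dots> = g1 x1 + g2 v" using opt by (simp add: algebra_simps)
  finally show False using 1 2 w by (simp add: algebra_simps)
qed

text \<open>Moving \<open>t\<close> from \<open>v\<close> to \<open>u\<close> cannot raise the sum
  above its optimum, so its right derivative \<open>m1 - m2\<close> at \<open>t = 0\<close> is at
  most 0. With the summands interchanged this gives equality.\<close>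

lemma optimal_derivative_le:
  assumes u: "u \<in> {x0..<x1}" and v: "v \<in> {x0'<..x1'}" and opt: "g (u + v) = g1 u + g2 v"
    and D1: "(g1 has_real_derivative m1) (at u within {x0..x1})"
    and D2: "(g2 has_real_derivative m2) (at v within {x0'..x1'})"
  shows "m1 \<le> m2"
proof -
  define e where "e = min (x1 - u) (v - x0')"
  have e: "e > 0" using u v by (simp add: e_def)
  have "(\<lambda>t. u + t) ` {0..e} \<subseteq> {x0..x1}" using u by (auto simp: e_def)
  then have "(g1 has_real_derivative m1) (at (u + 0) within (\<lambda>t. u + t) ` {0..e})"
    using D1 by (auto intro: DERIV_subset)
  moreover have "((\<lambda>t. u + t) has_real_derivative 1) (at 0 within {0..e})"
    by (auto intro!: derivative_eq_intros)
  ultimately have 1: "((g1 \<circ> (\<lambda>t. u + t)) has_real_derivative m1 * 1) (at 0 within {0..e})"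
    by (rule DERIV_image_chain)
  have "(\<lambda>t. v - t) ` {0..e} \<subseteq> {x0'..x1'}" using v by (auto simp: e_def)
  then have "(g2 has_real_derivative m2) (at (v - 0) within (\<lambda>t. v - t) ` {0..e})"
    using D2 by (auto intro: DERIV_subset)
  moreover have "((\<lambda>t. v - t) has_real_derivative -1) (at 0 within {0..e})"
    by (auto intro!: derivative_eq_intros)
  ultimately have 2: "((g2 \<circ> (\<lambda>t. v - t)) has_real_derivative m2 * -1) (at 0 within {0..e})"
    by (rule DERIV_image_chain)
  have lim: "((\<lambda>t. (g1 (u + t) + g2 (v - t) - (g1 u + g2 v)) / t) \<longlongrightarrow> m1 - m2) (at 0 within {0..e})"
    using DERIV_add[OF 1 2] by (simp add: has_field_derivative_iff o_def)
  have "\<forall>\<^sub>F t in at 0 within {0..e}. (g1 (u + t) + g2 (v - t) - (g1 u + g2 v)) / t \<le> 0"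
  proof (unfold eventually_at_filter, intro always_eventually allI impI)
    fix t assume "t \<noteq> 0" "t \<in> {0..e}"
    then show "(g1 (u + t) + g2 (v - t) - (g1 u + g2 v)) / t \<le> 0"
      using upper[of "u + t" "v - t"] u v opt by (auto simp: e_def divide_le_0_iff)
  qed
  moreover have "at 0 within {0..e} \<noteq> bot"
    using e by (simp add: trivial_limit_within islimpt_Icc)
  ultimately have "m1 - m2 \<le> 0"
    using lim by (intro tendsto_upperbound) auto
  then show ?thesis by simp
qed

text \<open>If \<open>u = x0\<close>, the slope 0 there forces a nonnegative slope of
  \<open>g2\<close> at \<open>v\<close>; the tangent at \<open>v\<close> then contradicts the strict
  maximum of \<open>g2\<close> at \<open>x0'\<close>.\<close>

lemma optimal_greater_left:
  assumes u: "u \<in> {x0..<x1}" and v: "v \<in> {x0'<..<x1'}" and opt: "g (u + v) = g1 u + g2 v"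
  shows "x0 < u"
proof (rule ccontr)
  assume "\<not> x0 < u"
  with u have [simp]: "u = x0" by simp
  obtain m2 where m2: "(g2 has_real_derivative m2) (at v within {x0'..x1'})"
    using tf2 v unfolding triangle_function_iff by force
  have "0 \<le> m2"
    using tf1 v u opt m2 by (intro optimal_derivative_le[of u v 0 m2]) (auto simp: triangle_function_def)
  moreover have "g2 x0' \<le> g2 v + m2 * (x0' - v)"
    using tf2 v m2 by (intro strictly_concave_on_below_tangent[of "{x0'..x1'}"]) (auto simp: triangle_function_def)
  ultimately have "g2 x0' \<le> g2 v"
    using v mult_nonneg_nonpos[of m2 "x0' - v"] by auto
  then show False using triangle_function_less_left[OF tf2, of v] v by auto
qed

text \<open>At the left end of the domain both components are left endpoints with slope 0; elsewhere
  both are interior and the slope inequality holds in both directions.\<close>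

lemma common_derivative:
  assumes z: "z \<in> {x0 + x0'..<x1 + x1'}"
  obtains u v m where "u \<in> {x0..<x1}" "v \<in> {x0'..<x1'}" "z = u + v" "g z = g1 u + g2 v"
    "(g1 has_real_derivative m) (at u within {x0..x1})"
    "(g2 has_real_derivative m) (at v within {x0'..x1'})"
    "u = x0 \<Longrightarrow> v = x0'" "z = x0 + x0' \<Longrightarrow> m = 0"
proof -
  interpret flip: sup_convolution x0' x1' g2 x0 x1 g1 g by (rule commute)
  obtain u v where uv: "u \<in> {x0..x1}" "v \<in> {x0'..x1'}" "z = u + v" "g z = g1 u + g2 v"
    using attained[of z] z by auto
  have "u < x1 \<or> v < x1'" using z uv by auto
  then have lt: "u < x1" "v < x1'"
    using optimal_less_right[of u v] flip.optimal_less_right[of v u] uv by (auto simp: add.commute)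
  show ?thesis
  proof (cases "z = x0 + x0'")
    case True
    then have [simp]: "u = x0" "v = x0'" using uv by auto
    show ?thesis
      using uv lt tf1 tf2 by (intro that[of x0 x0' 0]) (auto simp: triangle_function_def)
  next
    case False
    then have "x0 < u \<or> x0' < v" using uv by auto
    then have gt: "x0 < u" "x0' < v"
      using optimal_greater_left[of u v] flip.optimal_greater_left[of v u] uv lt by (auto simp: add.commute)
    obtain m1 m2 where m: "(g1 has_real_derivative m1) (at u within {x0..x1})"
      "(g2 has_real_derivative m2) (at v within {x0'..x1'})"
      using tf1 tf2 uv lt unfolding triangle_function_iff by (metis atLeastAtMost_iff atLeastLessThan_iff)
    have "m1 = m2"
      using optimal_derivative_le[of u v m1 m2] flip.optimal_derivative_le[of v u m2 m1] m uv lt gt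
      by (auto simp: add.commute)
    then show ?thesis
      using m uv lt gt False by (intro that[of u v m1]) auto
  qed
qed

text \<open>Squeeze: \<open>g\<close> lies below the line of slope \<open>m\<close> obtained by
  adding the two tangents and above the translate \<open>g1 (z - v) + g2 v\<close>; all three agree
  at \<open>u + v\<close>.\<close>

lemma has_derivative_sum:
  assumes u: "u \<in> {x0..<x1}" and v: "v \<in> {x0'..<x1'}" and opt: "g (u + v) = g1 u + g2 v"
    and D1: "(g1 has_real_derivative m) (at u within {x0..x1})"
    and D2: "(g2 has_real_derivative m) (at v within {x0'..x1'})"
    and left: "u = x0 \<Longrightarrow> v = x0'"
  shows "(g has_real_derivative m) (at (u + v) within {x0 + x0'..x1 + x1'})"
proof -
  define Y where "Y = {x0 + x0'..x1 + x1'} \<inter> {x0 + v..x1 + v}"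
  \<comment> \<open>\<open>Y\<close> is where \<open>z - v\<close> stays in the domain of
    \<open>g1\<close>. It is a neighbourhood of \<open>u + v\<close> in the whole domain, one-sided
    if \<open>u = x0\<close>, since then \<open>v = x0'\<close> as well.\<close>
  have "at (u + v) within {x0 + x0'..x1 + x1'} = at (u + v) within Y"
    by (rule at_within_nhd[of _ "if u = x0 then {..<x1 + v} else {x0 + v<..<x1 + v}"])
      (use u v left in \<open>auto simp: Y_def\<close>)
  moreover have "(g has_real_derivative m) (at (u + v) within Y)"
  proof -
    have "(\<lambda>z. z - v) ` Y \<subseteq> {x0..x1}" by (auto simp: Y_def)
    then have "(g1 has_real_derivative m) (at ((u + v) - v) within (\<lambda>z. z - v) ` Y)"
      using D1 by (auto intro: DERIV_subset)
    moreover have "((\<lambda>z. z - v) has_real_derivative 1) (at (u + v) within Y)"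
      by (auto intro!: derivative_eq_intros)
    ultimately have "((g1 \<circ> (\<lambda>z. z - v)) has_real_derivative m * 1) (at (u + v) within Y)"
      by (rule DERIV_image_chain)
    then have "((\<lambda>z. (g1 (z - v) - g1 u) / (z - (u + v)) - m) \<longlongrightarrow> 0) (at (u + v) within Y)"
      by (simp add: has_field_derivative_iff LIM_zero_iff)
    then have lim: "((\<lambda>z. \<bar>(g1 (z - v) - g1 u) / (z - (u + v)) - m\<bar>) \<longlongrightarrow> 0) (at (u + v) within Y)"
      by (rule tendsto_rabs_zero)
    have "((\<lambda>z. (g z - g (u + v)) / (z - (u + v)) - m) \<longlongrightarrow> 0) (at (u + v) within Y)"
    proof (rule Lim_null_comparison[OF _ lim], unfold eventually_at_filter,
        intro always_eventually allI impI)
      fix z assume z: "z \<noteq> u + v" "z \<in> Y"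
      then obtain p q where pq: "p \<in> {x0..x1}" "q \<in> {x0'..x1'}" "z = p + q" "g z = g1 p + g2 q"
        using attained[of z] by (auto simp: Y_def)
      have "g1 p \<le> g1 u + m * (p - u)" "g2 q \<le> g2 v + m * (q - v)"
        using tf1 tf2 u v D1 D2 pq
        by (auto simp: triangle_function_def intro!: strictly_concave_on_below_tangent)
      then have hi: "g z - g (u + v) - m * (z - (u + v)) \<le> 0"
        unfolding opt pq(4) unfolding pq(3) by (simp add: algebra_simps)
      have "g1 (z - v) + g2 v \<le> g (z - v + v)"
        using z v by (intro upper) (auto simp: Y_def)
      then have "g1 (z - v) - g1 u - m * (z - (u + v)) \<le> g z - g (u + v) - m * (z - (u + v))"
        by (simp add: opt)
      with hi have "\<bar>g z - g (u + v) - m * (z - (u + v))\<bar> \<le> \<bar>g1 (z - v) - g1 u - m * (z - (u + v))\<bar>"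
        by linarith
      then have "\<bar>g z - g (u + v) - m * (z - (u + v))\<bar> / \<bar>z - (u + v)\<bar>
          \<le> \<bar>g1 (z - v) - g1 u - m * (z - (u + v))\<bar> / \<bar>z - (u + v)\<bar>"
        by (rule divide_right_mono) simp
      then show "norm ((g z - g (u + v)) / (z - (u + v)) - m) \<le> \<bar>(g1 (z - v) - g1 u) / (z - (u + v)) - m\<bar>"
        using z by (simp add: abs_divide[symmetric] diff_divide_distrib del: abs_divide)
    qed
    then show ?thesis by (simp add: has_field_derivative_iff LIM_zero_iff)
  qed
  ultimately show ?thesis by simp
qed

text \<open>Combining optimal decompositions of \<open>z\<close> and \<open>z'\<close> decomposes
  the combined point; as \<open>z \<noteq> z'\<close>, at least one of the two component
  inequalities is strict.\<close>

lemma strictly_concave: "strictly_concave_on {x0 + x0'..x1 + x1'} g"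
  unfolding strictly_concave_on_def
proof (intro conjI ballI allI impI)
  fix z z' t :: real assume z: "z \<in> {x0 + x0'..x1 + x1'}" "z' \<in> {x0 + x0'..x1 + x1'}"
    and t: "z \<noteq> z' \<and> 0 < t \<and> t < 1"
  obtain u v where uv: "u \<in> {x0..x1}" "v \<in> {x0'..x1'}" "z = u + v" "g z = g1 u + g2 v"
    using attained[OF z(1)] by auto
  obtain u' v' where uv': "u' \<in> {x0..x1}" "v' \<in> {x0'..x1'}" "z' = u' + v'" "g z' = g1 u' + g2 v'"
    using attained[OF z(2)] by auto
  have sc: "strictly_concave_on {x0..x1} g1" "strictly_concave_on {x0'..x1'} g2"
    using tf1 tf2 by (auto simp: triangle_function_def)
  let ?u = "(1 - t) * u + t * u'" and ?v = "(1 - t) * v + t * v'"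
  have "u \<noteq> u' \<or> v \<noteq> v'" using t uv uv' by auto
  then have "((1 - t) * g1 u + t * g1 u') + ((1 - t) * g2 v + t * g2 v') < g1 ?u + g2 ?v"
    using strictly_concave_on_weak[OF sc(1) uv(1) uv'(1), of t]
      strictly_concave_on_weak[OF sc(2) uv(2) uv'(2), of t]
      strictly_concave_onD[OF sc(1) uv(1) uv'(1), of t]
      strictly_concave_onD[OF sc(2) uv(2) uv'(2), of t] t by fastforce
  also have "\<dots> \<le> g (?u + ?v)"
    using t uv uv' sc by (intro upper) (auto simp: strictly_concave_on_def convex_alt)
  also have "?u + ?v = (1 - t) * z + t * z'" by (simp add: uv uv' algebra_simps)
  finally show "(1 - t) * g z + t * g z' < g ((1 - t) * z + t * z')"
    by (simp add: uv(4) uv'(4) algebra_simps)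
qed simp

text \<open>Differentiability stops short of the right endpoint, so continuity is derived from the
  uniform continuity of \<open>g1\<close> and \<open>g2\<close>. A one-sided bound suffices, because
  \<open>z\<close> and \<open>z'\<close> can be exchanged.\<close>

lemma continuous: "continuous_on {x0 + x0'..x1 + x1'} g"
proof -
  have uc: "uniformly_continuous_on {x0..x1} g1" "uniformly_continuous_on {x0'..x1'} g2"
    using tf1 tf2 by (auto simp: triangle_function_def intro: compact_uniformly_continuous)
  have "\<exists>d>0. \<forall>z\<in>{x0 + x0'..x1 + x1'}. \<forall>z'\<in>{x0 + x0'..x1 + x1'}. \<bar>z' - z\<bar> < d \<longrightarrow> g z - g z' < e"
    if "e > 0" for e :: real
  proof -
    obtain d1 where d1: "d1 > 0"
      "\<And>u u'. \<lbrakk>u \<in> {x0..x1}; u' \<in> {x0..x1}; \<bar>u' - u\<bar> < d1\<rbrakk> \<Longrightarrow> \<bar>g1 u' - g1 u\<bar> < e / 2"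
      using uc(1) \<open>e > 0\<close> unfolding uniformly_continuous_on_def dist_real_def by (metis half_gt_zero)
    obtain d2 where d2: "d2 > 0"
      "\<And>u u'. \<lbrakk>u \<in> {x0'..x1'}; u' \<in> {x0'..x1'}; \<bar>u' - u\<bar> < d2\<rbrakk> \<Longrightarrow> \<bar>g2 u' - g2 u\<bar> < e / 2"
      using uc(2) \<open>e > 0\<close> unfolding uniformly_continuous_on_def dist_real_def by (metis half_gt_zero)
    have "g z - g z' < e"
      if z: "z \<in> {x0 + x0'..x1 + x1'}" "z' \<in> {x0 + x0'..x1 + x1'}" "\<bar>z' - z\<bar> < min d1 d2" for z z'
    proof -
      obtain u v where uv: "u \<in> {x0..x1}" "v \<in> {x0'..x1'}" "z = u + v" "g z = g1 u + g2 v"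
        using attained[OF z(1)] by auto
      \<comment> \<open>\<open>u\<close> absorbs as much of the shift \<open>z' - z\<close> as its
        interval allows and \<open>v\<close> takes the rest, so neither moves farther than the
        shift.\<close>
      define u' where "u' = (if z \<le> z' then min x1 (u + (z' - z)) else max x0 (u + (z' - z)))"
      have u': "u' \<in> {x0..x1}" "z' - u' \<in> {x0'..x1'}" "\<bar>u' - u\<bar> \<le> \<bar>z' - z\<bar>" "\<bar>(z' - u') - v\<bar> \<le> \<bar>z' - z\<bar>"
        using uv z by (auto simp: u'_def min_def max_def)
      have "\<bar>g1 u' - g1 u\<bar> < e / 2" "\<bar>g2 (z' - u') - g2 v\<bar> < e / 2"
        using u' uv z by (intro d1 d2; simp)+
      moreover have "g1 u' + g2 (z' - u') \<le> g z'" using upper[OF u'(1,2)] by simp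
      ultimately show ?thesis using uv(4) by linarith
    qed
    then show ?thesis using d1(1) d2(1) by (intro exI[of _ "min d1 d2"]) auto
  qed
  note close = this
  have "uniformly_continuous_on {x0 + x0'..x1 + x1'} g"
    unfolding uniformly_continuous_on_def dist_real_def
  proof (intro allI impI)
    fix e :: real assume "e > 0"
    from close[OF this] obtain d where d: "d > 0"
      "\<And>z z'. \<lbrakk>z \<in> {x0 + x0'..x1 + x1'}; z' \<in> {x0 + x0'..x1 + x1'}; \<bar>z' - z\<bar> < d\<rbrakk> \<Longrightarrow> g z - g z' < e"
      by blast
    have "\<bar>g z' - g z\<bar> < e"
      if "z \<in> {x0 + x0'..x1 + x1'}" "z' \<in> {x0 + x0'..x1 + x1'}" "\<bar>z' - z\<bar> < d" for z z'
      using d(2)[of z z'] d(2)[of z' z] that by (auto simp: abs_minus_commute)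
    then show "\<exists>d>0. \<forall>z\<in>{x0 + x0'..x1 + x1'}. \<forall>z'\<in>{x0 + x0'..x1 + x1'}. \<bar>z' - z\<bar> < d \<longrightarrow> \<bar>g z' - g z\<bar> < e"
      using d(1) by blast
  qed
  then show ?thesis by (rule uniformly_continuous_imp_continuous)
qed

text \<open>The slope of \<open>g\<close> at \<open>z\<close> is the slope of \<open>g1\<close> at
  some \<open>u \<ge> z - x1'\<close>. As \<open>z\<close> tends to the right end, \<open>u\<close>
  is forced to \<open>x1\<close>, where the slope of \<open>g1\<close> tends to minus
  infinity.\<close>

lemma triangle_function: "triangle_function (x0 + x0') (x1 + x1') g"
proof -
  have "\<exists>m. (g has_real_derivative m) (at z within {x0 + x0'..x1 + x1'}) \<and> (z = x0 + x0' \<longrightarrow> m = 0) \<and>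
      (\<exists>u\<in>{x0..<x1}. z - x1' \<le> u \<and> (g1 has_real_derivative m) (at u within {x0..x1}))"
    if "z \<in> {x0 + x0'..<x1 + x1'}" for z
  proof -
    from that show ?thesis
    proof (rule common_derivative)
      fix u v m
      assume *: "u \<in> {x0..<x1}" "v \<in> {x0'..<x1'}" "z = u + v" "g z = g1 u + g2 v"
        "(g1 has_real_derivative m) (at u within {x0..x1})"
        "(g2 has_real_derivative m) (at v within {x0'..x1'})"
        "u = x0 \<Longrightarrow> v = x0'" "z = x0 + x0' \<Longrightarrow> m = 0"
      then have "(g has_real_derivative m) (at z within {x0 + x0'..x1 + x1'})"
        using has_derivative_sum[of u v m] by simp
      moreover have "z - x1' \<le> u" using * by simp
      ultimately show ?thesis using * by blast
    qed
  qed
  then obtain D where D: "\<And>z. z \<in> {x0 + x0'..<x1 + x1'} \<Longrightarrow>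
      (g has_real_derivative D z) (at z within {x0 + x0'..x1 + x1'}) \<and> (z = x0 + x0' \<longrightarrow> D z = 0) \<and>
      (\<exists>u\<in>{x0..<x1}. z - x1' \<le> u \<and> (g1 has_real_derivative D z) (at u within {x0..x1}))"
    by metis
  have lt: "x0 < x1" "x0' < x1'" using tf1 tf2 by (auto simp: triangle_function_def)
  have "filterlim D at_bot (at_left (x1 + x1'))"
    unfolding filterlim_at_bot
  proof
    fix C
    have "\<forall>\<^sub>F x in at_left x1. deriv g1 x \<le> C"
      using tf1 by (simp add: triangle_function_def filterlim_at_bot)
    then obtain b where b: "b < x1" "\<And>x. \<lbrakk>b < x; x < x1\<rbrakk> \<Longrightarrow> deriv g1 x \<le> C"
      using eventually_at_left[OF lt(1)] by auto
    have "max b x0 + x1' < x1 + x1'" using b lt by simp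
    from eventually_at_left_real[OF this] show "\<forall>\<^sub>F z in at_left (x1 + x1'). D z \<le> C"
    proof (rule eventually_mono)
      fix z assume z: "z \<in> {max b x0 + x1'<..<x1 + x1'}"
      then have "z \<in> {x0 + x0'..<x1 + x1'}" using lt by auto
      then obtain u where u: "u \<in> {x0..<x1}" "z - x1' \<le> u"
        "(g1 has_real_derivative D z) (at u within {x0..x1})"
        using D by blast
      then have "max b x0 < u" using z by auto
      then have "deriv g1 u = D z" "deriv g1 u \<le> C"
        using u b(2)[of u] by (simp_all add: at_within_Icc_at DERIV_imp_deriv)
      then show "D z \<le> C" by simp
    qed
  qed
  then show ?thesis
    unfolding triangle_function_iff using D D[of "x0 + x0'"] lt strictly_concave continuous
    by (intro conjI exI[of _ D]) auto
qed

lemma subgraph: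
  "subgraph (x0 + x0') (x1 + x1') g =
     {p + q | p q. p \<in> subgraph x0 x1 g1 \<and> q \<in> subgraph x0' x1' g2}" (is "_ = ?R")
proof
  show "subgraph (x0 + x0') (x1 + x1') g \<subseteq> ?R"
  proof
    fix p assume p: "p \<in> subgraph (x0 + x0') (x1 + x1') g"
    then obtain u v where uv: "u \<in> {x0..x1}" "v \<in> {x0'..x1'}" "fst p = u + v"
      "g (fst p) = g1 u + g2 v"
      using attained[of "fst p"] by (auto simp: subgraph_def)
    have "p = (u, g1 u) + (v, snd p - g1 u)" using uv by (simp add: prod_eq_iff)
    moreover have "(u, g1 u) \<in> subgraph x0 x1 g1" "(v, snd p - g1 u) \<in> subgraph x0' x1' g2"
      using uv p by (auto simp: subgraph_def)
    ultimately show "p \<in> ?R" by blast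
  qed
  show "?R \<subseteq> subgraph (x0 + x0') (x1 + x1') g"
    using upper by (fastforce simp: subgraph_def)
qed

end

section \<open>Existence of the sup-convolution and of the sum of two triangles\<close>

lemma sup_convolution_exists:
  assumes "triangle_function x0 x1 g1" "triangle_function x0' x1' g2"
  shows "\<exists>g. sup_convolution x0 x1 g1 x0' x1' g2 g"
proof -
  have cont: "continuous_on {x0..x1} g1" "continuous_on {x0'..x1'} g2"
    using assms by (auto simp: triangle_function_def)
  \<comment> \<open>The \<open>u\<close> for which both \<open>u\<close> and \<open>z - u\<close>
    lie in their domains; compactness yields a maximizer \<open>U z\<close>.\<close>
  define K where "K z = {max x0 (z - x1')..min x1 (z - x0')}" for z
  have "\<exists>u\<in>K z. \<forall>u'\<in>K z. g1 u' + g2 (z - u') \<le> g1 u + g2 (z - u)"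
    if z: "z \<in> {x0 + x0'..x1 + x1'}" for z
  proof (rule continuous_attains_sup)
    show "compact (K z)" by (simp add: K_def)
    show "K z \<noteq> {}" using z assms by (auto simp: K_def triangle_function_def)
    show "continuous_on (K z) (\<lambda>u. g1 u + g2 (z - u))"
      by (intro continuous_intros continuous_on_compose2[OF cont(1)] continuous_on_compose2[OF cont(2)])
        (auto simp: K_def)
  qed
  then obtain U where U: "\<And>z. z \<in> {x0 + x0'..x1 + x1'} \<Longrightarrow>
      U z \<in> K z \<and> (\<forall>u'\<in>K z. g1 u' + g2 (z - u') \<le> g1 (U z) + g2 (z - U z))"
    by metis
  have "sup_convolution x0 x1 g1 x0' x1' g2 (\<lambda>z. g1 (U z) + g2 (z - U z))"
  proof
    fix z assume "z \<in> {x0 + x0'..x1 + x1'}"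
    from U[OF this] show "\<exists>u\<in>{x0..x1}. \<exists>v\<in>{x0'..x1'}. z = u + v \<and> g1 (U z) + g2 (z - U z) = g1 u + g2 v"
      by (intro bexI[of _ "U z"] bexI[of _ "z - U z"]) (auto simp: K_def)
  next
    fix u v assume "u \<in> {x0..x1}" "v \<in> {x0'..x1'}"
    then have "u + v \<in> {x0 + x0'..x1 + x1'}" "u \<in> K (u + v)" by (auto simp: K_def)
    then show "g1 u + g2 v \<le> g1 (U (u + v)) + g2 (u + v - U (u + v))"
      using U by fastforce
  qed (use assms in auto)
  then show ?thesis by blast
qed

lemma triangle_sum_exists:
  assumes tf: "triangle_function x0 x1 g1" "triangle_function x0' x1' g2" and e: "\<epsilon> > 0"
  shows "\<exists>y0 y1 g. triangle_sum x0 x1 g1 x0' x1' g2 \<epsilon> y0 y1 g"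
proof -
  obtain g where "sup_convolution x0 x1 g1 (\<epsilon> * x0') (\<epsilon> * x1') (\<lambda>x. \<epsilon> * g2 (x / \<epsilon>)) g"
    using sup_convolution_exists[OF tf(1) triangle_function_scale[OF tf(2) e]] by blast
  then interpret sup_convolution x0 x1 g1 "\<epsilon> * x0'" "\<epsilon> * x1'" "\<lambda>x. \<epsilon> * g2 (x / \<epsilon>)" g .
  have "subgraph (x0 + \<epsilon> * x0') (x1 + \<epsilon> * x1') g =
      {p + \<epsilon> *\<^sub>R q | p q. p \<in> subgraph x0 x1 g1 \<and> q \<in> subgraph x0' x1' g2}"
    unfolding subgraph subgraph_scale[OF e] by blast
  then show ?thesis
    using triangle_function unfolding triangle_sum_def by blast
qed

section \<open>Areas of triangles\<close>

lemma
  fixes A :: "(real \<times> real) set"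
  assumes A: "A \<in> sets borel"
  shows emeasure_lborel_slices_fst: "emeasure lborel A = (\<integral>\<^sup>+x. emeasure lborel (Pair x -` A) \<partial>lborel)"
    and emeasure_lborel_slices_snd:
      "emeasure lborel A = (\<integral>\<^sup>+y. emeasure lborel ((\<lambda>x. (x, y)) -` A) \<partial>lborel)"
proof -
  have "A \<in> sets (lborel \<Otimes>\<^sub>M lborel)"
    unfolding lborel_prod sets_lborel by (rule A)
  from lborel.emeasure_pair_measure_alt[OF this] lborel_pair.emeasure_pair_measure_alt2[OF this]
  show "emeasure lborel A = (\<integral>\<^sup>+x. emeasure lborel (Pair x -` A) \<partial>lborel)"
    "emeasure lborel A = (\<integral>\<^sup>+y. emeasure lborel ((\<lambda>x. (x, y)) -` A) \<partial>lborel)"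
    unfolding lborel_prod .
qed

text \<open>Each horizontal slice is merely translated, by an amount depending on \<open>y\<close>,
  so its length is preserved.\<close>

lemma emeasure_lborel_shear_fst:
  fixes A :: "(real \<times> real) set"
  assumes A: "A \<in> sets borel"
  shows "emeasure lborel ((\<lambda>(x, y). (x + k * y, y)) -` A) = emeasure lborel A"
proof -
  let ?f = "\<lambda>(x, y). (x + k * y, y) :: real \<times> real"
  have B: "?f -` A \<in> sets borel"
    using A by (intro measurable_sets_borel[OF borel_measurable_continuous_onI])
      (auto simp: split_def intro!: continuous_intros)
  have "emeasure lborel ((\<lambda>x. (x, y)) -` ?f -` A) = emeasure lborel ((\<lambda>x. (x, y)) -` A)" for y
  proof -
    have s: "(\<lambda>x. (x, y)) -` A \<in> sets borel"
      using A by (intro measurable_sets_borel[OF borel_measurable_continuous_onI])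
        (auto intro!: continuous_intros)
    have "emeasure lborel ((\<lambda>x. (x, y)) -` A) = emeasure (distr lborel borel ((+) (k * y))) ((\<lambda>x. (x, y)) -` A)"
      by (simp add: lborel_distr_plus)
    also have "\<dots> = emeasure lborel ((+) (k * y) -` (\<lambda>x. (x, y)) -` A)"
      using s by (simp add: emeasure_distr)
    also have "(+) (k * y) -` (\<lambda>x. (x, y)) -` A = (\<lambda>x. (x, y)) -` ?f -` A"
      by (auto simp: add.commute)
    finally show ?thesis by simp
  qed
  then show ?thesis
    by (simp only: emeasure_lborel_slices_snd[OF A] emeasure_lborel_slices_snd[OF B])
qed

lemma emeasure_lborel_swap:
  fixes A :: "(real \<times> real) set"
  assumes A: "A \<in> sets borel"
  shows "emeasure lborel (prod.swap -` A) = emeasure lborel A"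
proof -
  have B: "prod.swap -` A \<in> sets borel"
    using A by (intro measurable_sets_borel[OF borel_measurable_continuous_onI])
      (auto simp: prod.swap_def intro!: continuous_intros)
  have "Pair x -` prod.swap -` A = (\<lambda>y. (y, x)) -` A" for x
    by (auto simp: prod.swap_def)
  then show ?thesis
    by (simp only: emeasure_lborel_slices_snd[OF A] emeasure_lborel_slices_fst[OF B])
qed

text \<open>The clause for \<open>c = 0\<close> leaves a single shear in that case; the
  factorization in the other case divides by \<open>c\<close>. Natural entries of determinant 1
  satisfy the clause.\<close>

lemma emeasure_lborel_unimodular:
  fixes A :: "(real \<times> real) set"
  assumes A: "A \<in> sets borel" and det: "a * d - b * c = 1" and "c = 0 \<Longrightarrow> a = 1"
  shows "emeasure lborel ((\<lambda>(x, y). (a * x + b * y, c * x + d * y)) -` A) = emeasure lborel A"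
proof (cases "c = 0")
  case True
  with assms have "a = 1" "d = 1" by auto
  with True show ?thesis using emeasure_lborel_shear_fst[OF A, of b] by simp
next
  case False
  \<comment> \<open>The matrix is a product of three shears; the middle one is a horizontal shear conjugated by \<open>prod.swap\<close>.\<close>
  define U where "U k = (\<lambda>(x, y). (x + k * y, y) :: real \<times> real)" for k
  define p q where "p = (a - 1) / c" and "q = (d - 1) / c"
  have U_sets: "U k -` B \<in> sets borel" if "B \<in> sets borel" for k B
    using that unfolding U_def
    by (intro measurable_sets_borel[OF borel_measurable_continuous_onI])
      (auto simp: split_def intro!: continuous_intros)
  have swap_sets: "prod.swap -` B \<in> sets borel" if "B \<in> sets borel" for B :: "(real \<times> real) set"
    using that by (intro measurable_sets_borel[OF borel_measurable_continuous_onI])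
      (auto simp: prod.swap_def intro!: continuous_intros)
  have U: "emeasure lborel (U k -` B) = emeasure lborel B" if "B \<in> sets borel" for k B
    using emeasure_lborel_shear_fst[OF that] by (simp add: U_def)
  have "1 + p * c = a" "1 + c * q = d" using False by (auto simp: p_def q_def)
  moreover have "q + p * d = b" using False det by (simp add: p_def q_def field_simps)
  ultimately have "x + q * y + p * (y + c * (x + q * y)) = a * x + b * y"
    "y + c * (x + q * y) = c * x + d * y" for x y
    by (auto simp: algebra_simps simp flip: \<open>1 + p * c = a\<close> \<open>1 + c * q = d\<close> \<open>q + p * d = b\<close>)
  then have "(\<lambda>(x, y). (a * x + b * y, c * x + d * y)) = U p \<circ> prod.swap \<circ> U c \<circ> prod.swap \<circ> U q"
    by (auto simp: fun_eq_iff U_def)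
  then have "(\<lambda>(x, y). (a * x + b * y, c * x + d * y)) -` A
      = U q -` prod.swap -` U c -` prod.swap -` U p -` A"
    by (simp add: vimage_comp o_assoc)
  then show ?thesis
    using A by (simp add: U U_sets emeasure_lborel_swap swap_sets)
qed

lemma right_triangle_borel:
  "{(x, y). x \<le> \<alpha> \<and> y \<le> \<beta> \<and> \<kappa> < x + y} \<in> sets (borel :: (real \<times> real) measure)"
proof -
  have "{(x, y). x \<le> \<alpha> \<and> y \<le> \<beta> \<and> \<kappa> < x + y} =
      {p. fst p \<le> \<alpha>} \<inter> {p. snd p \<le> \<beta>} \<inter> {p. \<kappa> < fst p + snd p}"
    by auto
  also have "\<dots> \<in> sets borel"
    by (intro sets.Int borel_closed borel_open closed_Collect_le open_Collect_less continuous_intros)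
  finally show ?thesis .
qed

lemma emeasure_lborel_right_triangle:
  fixes \<alpha> \<beta> \<kappa> :: real
  assumes "\<kappa> \<le> \<alpha> + \<beta>"
  shows "emeasure lborel {(x, y). x \<le> \<alpha> \<and> y \<le> \<beta> \<and> \<kappa> < x + y} = ennreal ((\<alpha> + \<beta> - \<kappa>)\<^sup>2 / 2)"
proof -
  let ?T = "{(x, y). x \<le> \<alpha> \<and> y \<le> \<beta> \<and> \<kappa> < x + y}"
  have "emeasure lborel ?T = (\<integral>\<^sup>+x. emeasure lborel (Pair x -` ?T) \<partial>lborel)"
    by (rule emeasure_lborel_slices_fst[OF right_triangle_borel])
  also have "\<dots> = (\<integral>\<^sup>+x. ennreal (x + \<beta> - \<kappa>) * indicator {\<kappa> - \<beta>..\<alpha>} x \<partial>lborel)"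
  proof (intro nn_integral_cong)
    fix x
    have "Pair x -` ?T = (if x \<le> \<alpha> then {\<kappa> - x<..\<beta>} else {})" by auto
    then show "emeasure lborel (Pair x -` ?T) = ennreal (x + \<beta> - \<kappa>) * indicator {\<kappa> - \<beta>..\<alpha>} x"
      by (cases "\<kappa> - \<beta> \<le> x") (auto simp: indicator_def algebra_simps)
  qed
  also have "\<dots> = ennreal ((\<alpha> + \<beta> - \<kappa>)\<^sup>2 / 2 - (\<kappa> - \<beta> + \<beta> - \<kappa>)\<^sup>2 / 2)"
    using assms by (intro nn_integral_FTC_Icc) (auto intro!: derivative_eq_intros)
  finally show ?thesis by simp
qed

section \<open>Farey pairs and sublinear functions\<close>

text \<open>A subtractive Euclidean algorithm: \<open>m\<close> and \<open>n\<close> are positive,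
  and as long as the mediant is nonnegative it replaces one of the two vectors, which lowers
  \<open>m + n\<close>.\<close>

lemma farey_descent:
  fixes \<phi> :: "nat \<Rightarrow> nat \<Rightarrow> real"
  assumes hom: "\<And>k a b. \<phi> (k * a) (k * b) = real k * \<phi> a b"
    and "a * d = b * c + 1" "0 \<le> \<phi> a b" "0 \<le> \<phi> c d" "\<phi> (m * a + n * c) (m * b + n * d) < 0"
  shows "\<exists>a b c d. a * d = b * c + 1 \<and> 0 \<le> \<phi> a b \<and> 0 \<le> \<phi> c d \<and> \<phi> (a + c) (b + d) < 0"
  using assms(2-)
proof (induction "m + n" arbitrary: a b c d m n rule: less_induct)
  case less
  have "0 \<le> \<phi> (n * c) (n * d)" "0 \<le> \<phi> (m * a) (m * b)" using less.prems by (simp_all add: hom)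
  then have pos: "m > 0" "n > 0" using less.prems(4) by (auto intro!: gr0I)
  show ?case
  proof (cases "\<phi> (a + c) (b + d) < 0")
    case True
    then show ?thesis using less.prems by blast
  next
    case False
    show ?thesis
    proof (cases "n \<le> m")
      case True
      \<comment> \<open>The vector becomes \<open>k\<close> times \<open>(a, b)\<close> plus
        \<open>n\<close> times the mediant; the other case keeps \<open>(c, d)\<close>
        instead.\<close>
      then obtain k where k: "m = n + k" using le_Suc_ex by blast
      show ?thesis
        using less.prems False pos
        by (intro less.hyps[of k n a "b + d" b "a + c"]) (auto simp: k algebra_simps)
    next
      case nm: False
      then obtain k where k: "n = m + k" using le_Suc_ex by (metis nat_le_linear)
      show ?thesis
        using less.prems False pos
        by (intro less.hyps[of m k "a + c" d "b + d" c]) (auto simp: k algebra_simps)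
    qed
  qed
qed

text \<open>The directions in which a sublinear \<open>\<phi>\<close> is negative form a convex cone. If it contains the
  mediant of \<open>(a, b)\<close> and \<open>(c, d)\<close> but neither of these two vectors, then it lies strictly between
  them, so \<open>(p, q)\<close> is a positive integer combination of them.\<close>

lemma farey_mediant_le:
  fixes \<phi> :: "nat \<Rightarrow> nat \<Rightarrow> real"
  assumes hom: "\<And>k a b. \<phi> (k * a) (k * b) = real k * \<phi> a b"
    and sub: "\<And>a b c d. \<phi> (a + c) (b + d) \<le> \<phi> a b + \<phi> c d"
    and det: "a * d = b * c + 1" and "0 \<le> \<phi> a b" "0 \<le> \<phi> c d" "\<phi> (a + c) (b + d) < 0"
    and neg: "\<phi> p q < 0"
  shows "a + c \<le> p \<and> b + d \<le> q"
proof -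
  \<comment> \<open>Adding mediants to \<open>(p, q)\<close> keeps \<open>\<phi>\<close> negative,
    so the result is no integer multiple of a nonnegative direction: a positive multiple has
    \<open>\<phi> \<ge> 0\<close>, any other forces \<open>p = q = 0\<close>, where
    \<open>\<phi>\<close> vanishes.\<close>
  have no_multiple: False
    if "int p + int k * (int a + int c) = j * int a'" "int q + int k * (int b + int d) = j * int b'"
      and nonneg: "0 \<le> \<phi> a' b'" for k j a' b'
  proof (cases "j \<le> 0")
    case True
    then have "j * int a' \<le> 0" "j * int b' \<le> 0" by (simp_all add: mult_nonpos_nonneg)
    moreover have "0 \<le> int k * (int a + int c)" "0 \<le> int k * (int b + int d)" by simp_all
    ultimately have "p = 0" "q = 0" using that by linarith+
    then show False using neg hom[of 0 0 0] by simp
  next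
    case False
    then obtain i where i: "j = int i" by (metis nat_0_le linear)
    have "p + k * (a + c) = i * a'" "q + k * (b + d) = i * b'"
      using that(1,2) unfolding i by (simp_all flip: of_nat_add of_nat_mult)
    then have "real i * \<phi> a' b' \<le> \<phi> p q + real k * \<phi> (a + c) (b + d)"
      using sub[of p "k * (a + c)" q "k * (b + d)"] hom by simp
    moreover have "0 \<le> real i * \<phi> a' b'" using nonneg by simp
    moreover have "real k * \<phi> (a + c) (b + d) \<le> 0" using assms by (simp add: mult_nonneg_nonpos)
    ultimately show False using neg by linarith
  qed
  have idet: "int a * int d = int b * int c + 1"
    using det by (metis of_nat_1 of_nat_add of_nat_mult)
  \<comment> \<open>Cramer's rule for the coordinates of \<open>(p, q)\<close> in the basis
    \<open>(a, b)\<close>, \<open>(c, d)\<close>.\<close>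
  define m n where "m = int p * int d - int q * int c" and "n = int a * int q - int b * int p"
  have "m * int a + n * int c = int p * (int a * int d - int b * int c)"
    "m * int b + n * int d = int q * (int a * int d - int b * int c)"
    by (simp_all add: m_def n_def algebra_simps)
  then have pq: "int p = m * int a + n * int c" "int q = m * int b + n * int d"
    using idet by simp_all
  \<comment> \<open>If \<open>n \<le> 0\<close>, adding \<open>- n\<close> mediants cancels
    \<open>(c, d)\<close> and leaves \<open>m - n\<close> times \<open>(a, b)\<close>; the argument
    for \<open>m\<close> is symmetric.\<close>
  have "\<not> n \<le> 0"
  proof
    assume "n \<le> 0"
    then show False
      using no_multiple[of "nat (- n)" "m - n" a b] assms(4) by (simp add: pq algebra_simps)
  qed
  moreover have "\<not> m \<le> 0"
  proof
    assume "m \<le> 0"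
    then show False
      using no_multiple[of "nat (- m)" "n - m" c d] assms(5) by (simp add: pq algebra_simps)
  qed
  ultimately have "1 \<le> m" "1 \<le> n" by auto
  then have "1 * int a \<le> m * int a" "1 * int b \<le> m * int b" "1 * int c \<le> n * int c" "1 * int d \<le> n * int d"
    by (intro mult_right_mono; simp)+
  then have "int (a + c) \<le> int p" "int (b + d) \<le> int q" unfolding pq by simp_all
  then show ?thesis by simp
qed

text \<open>Both first vectors have determinant 1 with the common mediant, so they differ by
  \<open>k\<close> times it. Their first entries lie between 1 and that of the mediant, which leaves
  only \<open>k = 0\<close>.\<close>

lemma farey_parents_unique:
  fixes a b c d a' b' c' d' :: nat
  assumes "a * d = b * c + 1" "a' * d' = b' * c' + 1" "a + c = a' + c'" "b + d = b' + d'"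
  shows "(a, b, c, d) = (a', b', c', d')"
proof -
  define A B C D A' B' C' D' where "A = int a" and "B = int b" and "C = int c" and "D = int d"
    and "A' = int a'" and "B' = int b'" and "C' = int c'" and "D' = int d'"
  have det: "A * D = B * C + 1" "A' * D' = B' * C' + 1"
    using assms(1,2) by (metis A_def B_def C_def D_def A'_def B'_def C'_def D'_def of_nat_1 of_nat_add of_nat_mult)+
  have sum: "C = A' + C' - A" "D = B' + D' - B"
    using assms(3,4) by (auto simp: A_def B_def C_def D_def A'_def B'_def C'_def D'_def)
  have nn: "A \<ge> 1" "A' \<ge> 1" "C \<ge> 0" "C' \<ge> 0"
    using assms(1,2) by (cases a; cases a'; simp add: A_def A'_def C_def C'_def)+
  have det': "A * (B' + D') - B * (A' + C') = 1"
    using det unfolding sum by (simp add: algebra_simps)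
  define k where "k = A' * B - B' * A"
  have "A - A' = A * (A' * D' - B' * C') - A' * (A * (B' + D') - B * (A' + C'))"
    using det' det by simp
  also have "\<dots> = k * (A' + C')" by (simp add: k_def algebra_simps)
  finally have A: "A - A' = k * (A' + C')" .
  have "B - B' = B * (A' * D' - B' * C') - B' * (A * (B' + D') - B * (A' + C'))"
    using det' det by simp
  also have "\<dots> = k * (B' + D')" by (simp add: k_def algebra_simps)
  finally have B: "B - B' = k * (B' + D')" .
  have "\<not> k \<ge> 1"
  proof
    assume "k \<ge> 1"
    then have "A' + C' \<le> A - A'"
      unfolding A using nn mult_right_mono[of 1 k "A' + C'"] by simp
    then show False using nn sum(1) by presburger
  qed
  moreover have "\<not> k \<le> -1"
  proof
    assume "k \<le> -1"
    then have "A - A' \<le> -1 * (A' + C')" unfolding A using nn by (intro mult_right_mono) auto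
    then show False using nn by presburger
  qed
  ultimately have "k = 0" by linarith
  then have "A = A'" "B = B'" using A B by simp_all
  with sum show ?thesis
    by (simp add: A_def B_def C_def D_def A'_def B'_def C'_def D'_def)
qed

section \<open>Supporting lines\<close>

lemma supporting_line_exists:
  assumes "continuous_on {x0..x1} g" "x0 \<le> x1"
  shows "\<exists>\<gamma>. supporting_line x0 x1 g a b \<gamma>"
proof -
  have "\<exists>x\<in>{x0..x1}. \<forall>y\<in>{x0..x1}. real a * y + real b * g y \<le> real a * x + real b * g x"
    using assms by (intro continuous_attains_sup continuous_intros) auto
  then show ?thesis unfolding supporting_line_def by blast
qed

lemma supporting_line_unique:
  assumes "supporting_line x0 x1 g a b \<gamma>" "supporting_line x0 x1 g a b \<gamma>'"
  shows "\<gamma> = \<gamma>'"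
  using assms unfolding supporting_line_def by (metis order_antisym)

lemma supporting_line_scale:
  assumes "supporting_line x0 x1 g a b \<gamma>"
  shows "supporting_line x0 x1 g (k * a) (k * b) (real k * \<gamma>)"
proof -
  have eq: "real (k * a) * x + real (k * b) * g x = real k * (real a * x + real b * g x)" for x
    by (simp add: algebra_simps)
  show ?thesis
    using assms unfolding supporting_line_def eq by (auto intro: mult_left_mono)
qed

lemma supporting_line_add_le:
  assumes "supporting_line x0 x1 g a b \<gamma>" "supporting_line x0 x1 g c d \<delta>"
    "supporting_line x0 x1 g (a + c) (b + d) \<eta>"
  shows "\<eta> \<le> \<gamma> + \<delta>"
proof -
  obtain x where x: "x \<in> {x0..x1}" "real (a + c) * x + real (b + d) * g x = \<eta>"
    using assms(3) by (auto simp: supporting_line_def)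
  have "real a * x + real b * g x \<le> \<gamma>" "real c * x + real d * g x \<le> \<delta>"
    using assms x by (auto simp: supporting_line_def)
  then show ?thesis using x(2) by (simp add: algebra_simps)
qed

text \<open>The tangent at \<open>x\<close> separates \<open>(x, y)\<close> from the graph, but its
  slope may be irrational. A slight tilt to a rational slope \<open>- t\<close> still separates and,
  as \<open>t > 0\<close>, gives natural coefficients.\<close>

lemma separating_supporting_line:
  assumes tf: "triangle_function x0 x1 g" and x: "x \<in> {x0<..<x1}" and y: "g x < y"
  shows "\<exists>a b. \<forall>\<gamma>. supporting_line x0 x1 g a b \<gamma> \<longrightarrow> \<gamma> < real a * x + real b * y"
proof -
  have sc: "strictly_concave_on {x0..x1} g" using tf by (simp add: triangle_function_def)
  obtain m where m: "(g has_real_derivative m) (at x within {x0..x1})"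
    using tf x unfolding triangle_function_iff by force
  note tangent = strictly_concave_on_below_tangent[OF sc _ _ m]
  have "g x < g x0" using triangle_function_less_left[OF tf] x by simp
  also have "g x0 \<le> g x + m * (x0 - x)" using x by (intro tangent) auto
  finally have "m < 0" using x by (simp add: zero_less_mult_iff)
  \<comment> \<open>The tilt \<open>t + m\<close> stays below \<open>\<eta>\<close>, so up to
    \<open>x1\<close> the tilted line uses up less than the gap \<open>y - g x\<close>.\<close>
  define \<eta> where "\<eta> = (y - g x) / (x1 - x)"
  have "\<eta> > 0" using x y by (simp add: \<eta>_def)
  then obtain t where t: "t \<in> \<rat>" "- m < t" "t < - m + \<eta>"
    using Rats_dense_in_real[of "- m" "- m + \<eta>"] by auto
  obtain a b :: nat where ab: "b \<noteq> 0" "\<bar>t\<bar> = real a / real b"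
    using Rats_abs_nat_div_natE[OF t(1)] by metis
  have a: "real a = t * real b" using ab t \<open>m < 0\<close> by (simp add: field_simps)
  have "\<gamma> < real a * x + real b * y" if \<gamma>: "supporting_line x0 x1 g a b \<gamma>" for \<gamma>
  proof -
    obtain z where z: "z \<in> {x0..x1}" "\<gamma> = real a * z + real b * g z"
      using \<gamma> by (auto simp: supporting_line_def)
    have "g z \<le> g x + m * (z - x)" using x z by (intro tangent) auto
    moreover have "(t + m) * (z - x) < y - g x"
    proof -
      have "(t + m) * (z - x) \<le> (t + m) * (x1 - x)" using t z by (intro mult_left_mono) auto
      also have "\<dots> < \<eta> * (x1 - x)" using t x by (intro mult_strict_right_mono) auto
      also have "\<dots> = y - g x" using x by (simp add: \<eta>_def)
      finally show ?thesis .
    qed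
    ultimately have "t * z + g z < t * x + y" by (simp add: algebra_simps)
    then have "real b * (t * z + g z) < real b * (t * x + y)" using ab by simp
    then show ?thesis unfolding z(2) a by (simp add: algebra_simps)
  qed
  then show ?thesis by blast
qed

section \<open>Dissection of a triangle\<close>

definition unimodular_rows :: "(nat \<times> nat \<times> nat \<times> nat) set" where
  "unimodular_rows = {(a, b, c, d). int a * int d - int b * int c = 1}"

lemma mem_unimodular_rows: "(a, b, c, d) \<in> unimodular_rows \<longleftrightarrow> a * d = b * c + 1"
proof -
  have "int a * int d - int b * int c = 1 \<longleftrightarrow> int (a * d) = int (b * c + 1)" by auto
  then show ?thesis unfolding unimodular_rows_def by (simp only: mem_Collect_eq case_prod_conv of_nat_eq_iff)
qed

text \<open>Closed along the two old sides and open along the cut, so that triangles cut off later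
  share no boundary points with it.\<close>

fun corner_triangle ::
    "(nat \<Rightarrow> nat \<Rightarrow> real) \<Rightarrow> nat \<times> nat \<times> nat \<times> nat \<Rightarrow> (real \<times> real) set" where
  "corner_triangle h (a, b, c, d) =
     {(x, y). real a * x + real b * y \<le> h a b \<and> real c * x + real d * y \<le> h c d \<and>
        h (a + c) (b + d) < real (a + c) * x + real (b + d) * y}"

lemma
  assumes "(a, b, c, d) \<in> unimodular_rows" "h (a + c) (b + d) \<le> h a b + h c d"
  shows corner_triangle_borel: "corner_triangle h (a, b, c, d) \<in> sets borel" (is ?b)
    and emeasure_corner_triangle: "emeasure lborel (corner_triangle h (a, b, c, d)) =
      ennreal ((h a b + h c d - h (a + c) (b + d))\<^sup>2 / 2)" (is ?e)
proof -
  let ?f = "\<lambda>(x, y). (real a * x + real b * y, real c * x + real d * y)"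
  let ?T = "{(x, y). x \<le> h a b \<and> y \<le> h c d \<and> h (a + c) (b + d) < x + y}"
  have det: "a * d = b * c + 1" using assms by (simp add: mem_unimodular_rows)
  have eq: "corner_triangle h (a, b, c, d) = ?f -` ?T" by (auto simp: algebra_simps)
  show ?b unfolding eq
    by (intro measurable_sets_borel[OF borel_measurable_continuous_onI] right_triangle_borel)
      (auto simp: split_def intro!: continuous_intros)
  have "real (a * d) = real (b * c + 1)" using det by (rule arg_cong)
  then have "real a * real d - real b * real c = 1" by simp
  moreover have "c = 0 \<Longrightarrow> a = 1" using det by simp
  ultimately show ?e unfolding eq
    using assms(2) by (subst emeasure_lborel_unimodular) 
      (auto simp: right_triangle_borel emeasure_lborel_right_triangle)
qed

text \<open>\<open>h\<close> covers all pairs, not only primitive ones, so that homogeneity and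
  subadditivity hold without side conditions.\<close>

locale support_coefficients =
  fixes x0 x1 :: real and g :: "real \<Rightarrow> real" and h :: "nat \<Rightarrow> nat \<Rightarrow> real"
  assumes tf: "triangle_function x0 x1 g" and supp: "\<And>a b. supporting_line x0 x1 g a b (h a b)"
begin

text \<open>Negative exactly when the supporting line in direction \<open>(a, b)\<close> cuts off
  the point \<open>(x, y)\<close>. For a fixed point it is sublinear in the direction and serves as
  \<open>\<phi>\<close> in the Farey lemmas.\<close>

definition slack :: "real \<Rightarrow> real \<Rightarrow> nat \<Rightarrow> nat \<Rightarrow> real" where
  "slack x y a b = h a b - (real a * x + real b * y)"

lemma subadditive: "h (a + c) (b + d) \<le> h a b + h c d"
  by (rule supporting_line_add_le[OF supp supp supp])

lemma slack_homogeneous: "slack x y (k * a) (k * b) = real k * slack x y a b"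
  using supporting_line_unique[OF supp supporting_line_scale[OF supp], of k a b]
  by (simp add: slack_def algebra_simps)

lemma slack_subadditive: "slack x y (a + c) (b + d) \<le> slack x y a b + slack x y c d"
  using subadditive[of a c b d] by (simp add: slack_def algebra_simps)

lemma mem_corner_triangle:
  "(x, y) \<in> corner_triangle h (a, b, c, d) \<longleftrightarrow>
     0 \<le> slack x y a b \<and> 0 \<le> slack x y c d \<and> slack x y (a + c) (b + d) < 0"
  by (simp add: slack_def)

lemma slack_one_zero: "slack x y 1 0 = x1 - x"
proof -
  have "supporting_line x0 x1 g 1 0 x1"
    using tf by (auto simp: supporting_line_def triangle_function_def)
  from supporting_line_unique[OF supp this] show ?thesis by (simp add: slack_def)
qed

lemma slack_zero_one: "slack x y 0 1 = g x0 - y"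
proof -
  have "supporting_line x0 x1 g 0 1 (g x0)"
    using tf triangle_function_le_left[OF tf] by (force simp: supporting_line_def triangle_function_def)
  from supporting_line_unique[OF supp this] show ?thesis by (simp add: slack_def)
qed

lemma slack_nonneg:
  assumes "u \<in> {x0..x1}" "x \<le> u" "y \<le> g u"
  shows "0 \<le> slack x y a b"
proof -
  have "real a * x + real b * y \<le> real a * u + real b * g u"
    using assms by (intro add_mono mult_left_mono) auto
  also have "\<dots> \<le> h a b" using supp[of a b] assms by (auto simp: supporting_line_def)
  finally show ?thesis by (simp add: slack_def)
qed

text \<open>At a common point both mediants have negative slack, so \<open>farey_mediant_le\<close>
  bounds each by the other. Equal mediants have equal parents.\<close>

lemma disjoint_corner_triangles: "disjoint_family_on (corner_triangle h) unimodular_rows"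
  unfolding disjoint_family_on_def
proof (intro ballI impI, rule ccontr)
  fix s t assume s: "s \<in> unimodular_rows" and t: "t \<in> unimodular_rows" and "s \<noteq> t"
    and "corner_triangle h s \<inter> corner_triangle h t \<noteq> {}"
  obtain a b c d where s': "s = (a, b, c, d)" by (cases s)
  obtain a' b' c' d' where t': "t = (a', b', c', d')" by (cases t)
  obtain x y where "(x, y) \<in> corner_triangle h s" "(x, y) \<in> corner_triangle h t"
    using \<open>corner_triangle h s \<inter> corner_triangle h t \<noteq> {}\<close> by auto
  then have xy:
    "0 \<le> slack x y a b" "0 \<le> slack x y c d" "slack x y (a + c) (b + d) < 0"
    "0 \<le> slack x y a' b'" "0 \<le> slack x y c' d'" "slack x y (a' + c') (b' + d') < 0"
    unfolding s' t' mem_corner_triangle by auto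
  have det: "a * d = b * c + 1" "a' * d' = b' * c' + 1"
    using s t by (simp_all add: s' t' mem_unimodular_rows)
  note le = farey_mediant_le[of "slack x y", OF slack_homogeneous slack_subadditive]
  have "a + c = a' + c'" "b + d = b' + d'"
    using le[OF det(1) xy(1-3) xy(6)] le[OF det(2) xy(4-6) xy(3)] by auto
  then have "s = t" unfolding s' t' by (rule farey_parents_unique[OF det])
  with \<open>s \<noteq> t\<close> show False ..
qed

lemma corner_triangle_subset:
  assumes s: "s \<in> unimodular_rows"
  shows "corner_triangle h s \<subseteq> g_triangle x0 x1 g"
proof (rule subrelI)
  fix x y assume xy: "(x, y) \<in> corner_triangle h s"
  obtain a b c d where s': "s = (a, b, c, d)" by (cases s)
  have det: "a * d = b * c + 1" using s by (simp add: s' mem_unimodular_rows)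
  then have "a \<noteq> 0" "d \<noteq> 0" by (cases a; cases d; simp)+
  note xy = xy[unfolded s' mem_corner_triangle]
  note le = farey_mediant_le[of "slack x y", OF slack_homogeneous slack_subadditive det]
  \<comment> \<open>Negative slack at \<open>(1, 0)\<close> would put the mediant componentwise
    below \<open>(1, 0)\<close>, hence \<open>d = 0\<close>. The bound on \<open>y\<close> is
    analogous.\<close>
  have x: "x \<le> x1" using le[of 1 0] xy \<open>d \<noteq> 0\<close> slack_one_zero[of x y] by linarith
  have y: "y \<le> g x0" using le[of 0 1] xy \<open>a \<noteq> 0\<close> slack_zero_one[of x y] by linarith
  have "x0 \<le> x1" using tf by (simp add: triangle_function_def)
  \<comment> \<open>A point left of \<open>x0\<close> or below the graph is dominated by a graph
    point, so its slack would be nonnegative in every direction, the mediant included.\<close>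
  then have x0: "x0 \<le> x" using slack_nonneg[of x0 x y "a + c" "b + d"] xy y by (cases "x0 \<le> x") auto
  have "g x \<le> y" using slack_nonneg[of x x y "a + c" "b + d"] xy x x0 by (cases "g x \<le> y") auto
  with x y x0 show "(x, y) \<in> g_triangle x0 x1 g" by (simp add: g_triangle_def)
qed

text \<open>A separating supporting line gives a direction of negative slack, while
  \<open>(1, 0)\<close> and \<open>(0, 1)\<close> have nonnegative slack; Farey descent from that
  pair finds the triangle.\<close>

lemma interior_covered:
  assumes x: "x \<in> {x0<..<x1}" and y: "g x < y" "y \<le> g x0"
  shows "(x, y) \<in> (\<Union>s\<in>unimodular_rows. corner_triangle h s)"
proof -
  obtain a b where "h a b < real a * x + real b * y"
    using separating_supporting_line[OF tf x y(1)] supp by blast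
  then have "slack x y a b < 0" by (simp add: slack_def)
  then have "\<exists>a b c d. a * d = b * c + 1 \<and> 0 \<le> slack x y a b \<and> 0 \<le> slack x y c d \<and>
      slack x y (a + c) (b + d) < 0"
    using x y slack_one_zero slack_zero_one
    by (intro farey_descent[of "slack x y" 1 1 0 0 a b, OF slack_homogeneous]) auto
  then show ?thesis
    unfolding mem_corner_triangle[symmetric] mem_unimodular_rows[symmetric] by blast
qed

lemma g_triangle_borel: "g_triangle x0 x1 g \<in> sets borel"
proof -
  have "continuous_on {x0..x1} g" using tf by (simp add: triangle_function_def)
  then have "continuous_on ({x0..x1} \<times> UNIV) (\<lambda>p :: real \<times> real. g (fst p))"
    by (rule continuous_on_compose2) (auto intro: continuous_intros)
  then have "continuous_on ({x0..x1} \<times> UNIV) (\<lambda>p. g (fst p) - snd p)"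
    by (intro continuous_intros)
  then have "closed ({x0..x1} \<times> UNIV \<inter> (\<lambda>p. g (fst p) - snd p) -` {..0})"
    by (intro continuous_closed_preimage closed_Times) auto
  moreover have "closed {p :: real \<times> real. snd p \<le> g x0}"
    by (intro closed_Collect_le continuous_intros)
  moreover have "g_triangle x0 x1 g =
      ({x0..x1} \<times> UNIV \<inter> (\<lambda>p. g (fst p) - snd p) -` {..0}) \<inter> {p. snd p \<le> g x0}"
    by (auto simp: g_triangle_def)
  ultimately show ?thesis by (simp add: closed_Int)
qed

lemma emeasure_g_triangle_finite: "emeasure lborel (g_triangle x0 x1 g) < \<infinity>"
proof -
  have "continuous_on {x0..x1} g" "{x0..x1} \<noteq> {}"
    using tf by (auto simp: triangle_function_def)
  then obtain z where z: "\<And>x. x \<in> {x0..x1} \<Longrightarrow> g z \<le> g x"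
    using continuous_attains_inf[of "{x0..x1}" g] compact_Icc by metis
  have "g_triangle x0 x1 g \<subseteq> cbox (x0, g z) (x1, g x0)"
  proof (rule subrelI)
    fix x y assume "(x, y) \<in> g_triangle x0 x1 g"
    with z[of x] show "(x, y) \<in> cbox (x0, g z) (x1, g x0)"
      by (simp add: g_triangle_def cbox_Pair_eq)
  qed
  then have "emeasure lborel (g_triangle x0 x1 g) \<le> emeasure lborel (cbox (x0, g z) (x1, g x0))"
    by (rule emeasure_mono) simp
  also have "\<dots> < \<infinity>" by (rule emeasure_lborel_cbox_finite)
  finally show ?thesis .
qed

text \<open>For \<open>x \<noteq> x1\<close> the part missed by the corner triangles has vertical
  slices of at most one point, hence it is null.\<close>

lemma emeasure_g_triangle:
  "emeasure lborel (g_triangle x0 x1 g) = 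
     (\<integral>\<^sup>+s. emeasure lborel (corner_triangle h s) \<partial>count_space unimodular_rows)"
proof -
  define V where "V = (\<Union>s\<in>unimodular_rows. corner_triangle h s)"
  have sets: "corner_triangle h s \<in> sets borel" if "s \<in> unimodular_rows" for s
    using that by (cases s) (auto intro!: corner_triangle_borel subadditive simp del: corner_triangle.simps)
  then have V: "V \<in> sets borel" unfolding V_def by (intro sets.countable_UN') auto
  have "V \<subseteq> g_triangle x0 x1 g" unfolding V_def using corner_triangle_subset by blast
  have R: "g_triangle x0 x1 g - V \<in> sets borel" using V g_triangle_borel by blast
  have "emeasure lborel (g_triangle x0 x1 g - V) =
      (\<integral>\<^sup>+x. emeasure lborel (Pair x -` (g_triangle x0 x1 g - V)) \<partial>lborel)"
    by (rule emeasure_lborel_slices_fst[OF R])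
  also have "\<dots> = (\<integral>\<^sup>+x. 0 \<partial>(lborel :: real measure))"
  proof (rule nn_integral_cong_AE, rule AE_mp[OF AE_lborel_singleton[of x1]], intro AE_I2 impI)
    fix x :: real assume "x \<noteq> x1"
    have "Pair x -` (g_triangle x0 x1 g - V) \<subseteq> {g x}"
    proof
      fix y assume "y \<in> Pair x -` (g_triangle x0 x1 g - V)"
      then have y: "x0 \<le> x" "x \<le> x1" "g x \<le> y" "y \<le> g x0" "(x, y) \<notin> V"
        by (auto simp: g_triangle_def)
      show "y \<in> {g x}"
      proof (cases "x = x0")
        case False
        with y \<open>x \<noteq> x1\<close> have "x \<in> {x0<..<x1}" by simp
        then have "\<not> g x < y" using interior_covered y(4,5) unfolding V_def by blast
        with y show ?thesis by simp
      qed (use y in simp)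
    qed
    then have "emeasure lborel (Pair x -` (g_triangle x0 x1 g - V)) \<le> emeasure lborel {g x}"
      by (rule emeasure_mono) simp
    then show "emeasure lborel (Pair x -` (g_triangle x0 x1 g - V)) = 0" by simp
  qed
  finally have "emeasure lborel (g_triangle x0 x1 g) = emeasure lborel V"
    using emeasure_Un_null_set[of V lborel "g_triangle x0 x1 g - V"] V R \<open>V \<subseteq> _\<close>
    by (auto simp: null_sets_def Un_absorb1)
  also have "\<dots> = (\<integral>\<^sup>+s. emeasure lborel (corner_triangle h s) \<partial>count_space unimodular_rows)"
    unfolding V_def using sets disjoint_corner_triangles by (intro emeasure_UN_countable) auto
  finally show ?thesis .
qed

end

section \<open>From the dissection to the area formula and the mixed area\<close>

lemma has_sum_nn_integral_count_space:
  fixes f :: "'a \<Rightarrow> real"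
  assumes "\<And>x. x \<in> A \<Longrightarrow> 0 \<le> f x" "0 \<le> S" "(\<integral>\<^sup>+x. ennreal (f x) \<partial>count_space A) = ennreal S"
  shows "(f has_sum S) A"
proof -
  have b: "has_bochner_integral (count_space A) f S"
    using assms by (intro has_bochner_integral_nn_integral) (auto simp: AE_count_space)
  then have "Infinite_Set_Sum.abs_summable_on f A"
    by (simp add: abs_summable_on_def has_bochner_integral_iff)
  moreover have "infsetsum f A = S"
    using b by (simp add: infsetsum_def has_bochner_integral_iff)
  ultimately show ?thesis
    by (metis abs_summable_equivalent abs_summable_summable has_sum_infsum infsetsum_infsum)
qed

theorem area_g_triangle:
  assumes tf: "triangle_function x0 x1 g"
    and coeff: "\<And>a b. coprime a b \<Longrightarrow> supporting_line x0 x1 g a b (\<gamma> a b)"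
  shows "((\<lambda>(a, b, c, d). (\<gamma> a b + \<gamma> c d - \<gamma> (a + c) (b + d))\<^sup>2)
    has_sum 2 * measure lborel (g_triangle x0 x1 g)) {(a, b, c, d). int a * int d - int b * int c = 1}"
proof -
  \<comment> \<open>\<open>\<gamma>\<close> is prescribed only for coprime pairs; \<open>h\<close>
    extends it to all of them.\<close>
  obtain h where h: "\<And>a b. supporting_line x0 x1 g a b (h a b)"
    using supporting_line_exists[of x0 x1 g] tf by (metis triangle_function_def less_imp_le)
  interpret support_coefficients x0 x1 g h by unfold_locales (rule tf, rule h)
  have h_eq: "h a b = \<gamma> a b" if "coprime a b" for a b
    using supporting_line_unique[OF h coeff[OF that]] .
  let ?f = "\<lambda>(a, b, c, d). (\<gamma> a b + \<gamma> c d - \<gamma> (a + c) (b + d))\<^sup>2 / 2"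
  have "emeasure lborel (corner_triangle h s) = ennreal (?f s)" if "s \<in> unimodular_rows" for s
  proof -
    obtain a b c d where s: "s = (a, b, c, d)" by (cases s)
    have det: "int a * int d - int b * int c = 1" using that by (simp add: s unimodular_rows_def)
    \<comment> \<open>A Bezout identity certifies coprimality; for the mediant it is
      \<open>(a + c) * d - (b + d) * c = 1\<close>.\<close>
    have cop: "coprime p q" if "int p * i + int q * j = 1" for p q i j
      using that by (metis coprime_int_iff coprimeI dvd_add dvd_mult2)
    have "coprime a b" "coprime c d" "coprime (a + c) (b + d)"
      using det cop[of a d b "- c"] cop[of c "- b" d a] cop[of "a + c" d "b + d" "- c"]
      by (simp_all add: algebra_simps)
    then show ?thesis
      using emeasure_corner_triangle[of a b c d h, OF that[unfolded s] subadditive] by (simp add: s h_eq)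
  qed
  then have "(\<integral>\<^sup>+s. ennreal (?f s) \<partial>count_space unimodular_rows) = emeasure lborel (g_triangle x0 x1 g)"
    unfolding emeasure_g_triangle by (intro nn_integral_cong) simp
  also have "\<dots> = ennreal (measure lborel (g_triangle x0 x1 g))"
    using emeasure_g_triangle_finite by (simp add: emeasure_eq_ennreal_measure)
  finally have "(?f has_sum measure lborel (g_triangle x0 x1 g)) unimodular_rows"
    by (intro has_sum_nn_integral_count_space) auto
  from has_sum_cmult_right[OF this, of 2] show ?thesis
    by (simp add: unimodular_rows_def case_prod_unfold)
qed

theorem theorem7:
  fixes g1 g2 :: "real \<Rightarrow> real" and x0 x1 x0' x1' :: real
    and \<gamma> \<delta> :: "nat \<Rightarrow> nat \<Rightarrow> real"
  assumes "triangle_function x0 x1 g1"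
    and "triangle_function x0' x1' g2"
    and "\<And>a b. coprime a b \<Longrightarrow> supporting_line x0 x1 g1 a b (\<gamma> a b)"
    and "\<And>a b. coprime a b \<Longrightarrow> supporting_line x0' x1' g2 a b (\<delta> a b)"
  shows "\<exists>M. has_mixed_area x0 x1 g1 x0' x1' g2 M \<and>
    ((\<lambda>(a, b, c, d). (\<gamma> a b + \<gamma> c d - \<gamma> (a + c) (b + d)) * (\<delta> a b + \<delta> c d - \<delta> (a + c) (b + d)))
      has_sum M) {(a, b, c, d). int a * int d - int b * int c = 1}"
proof -
  let ?S = "{(a, b, c, d). int a * int d - int b * int c = 1}"
  define p where "p = (\<lambda>(a, b, c, d). \<gamma> a b + \<gamma> c d - \<gamma> (a + c) (b + d))"
  define q where "q = (\<lambda>(a, b, c, d). \<delta> a b + \<delta> c d - \<delta> (a + c) (b + d))"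
  define A B where "A = measure lborel (g_triangle x0 x1 g1)" and "B = measure lborel (g_triangle x0' x1' g2)"
  have sum_area: "((\<lambda>s. (p s + \<epsilon> * q s)\<^sup>2) has_sum 2 * measure lborel (g_triangle y0 y1 g)) ?S"
    if "triangle_sum x0 x1 g1 x0' x1' g2 \<epsilon> y0 y1 g" "\<epsilon> > 0" for \<epsilon> y0 y1 g
  proof -
    have "triangle_function y0 y1 g" using that by (simp add: triangle_sum_def)
    moreover have "supporting_line y0 y1 g a b (\<gamma> a b + \<epsilon> * \<delta> a b)" if "coprime a b" for a b
      using triangle_sum_supporting_line that assms(3,4) \<open>triangle_sum _ _ _ _ _ _ _ _ _ _\<close> \<open>\<epsilon> > 0\<close> by blast
    ultimately have "((\<lambda>(a, b, c, d). ((\<gamma> a b + \<epsilon> * \<delta> a b) + (\<gamma> c d + \<epsilon> * \<delta> c d)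
        - (\<gamma> (a + c) (b + d) + \<epsilon> * \<delta> (a + c) (b + d)))\<^sup>2) has_sum 2 * measure lborel (g_triangle y0 y1 g)) ?S"
      by (rule area_g_triangle)
    moreover have "(\<lambda>(a, b, c, d). ((\<gamma> a b + \<epsilon> * \<delta> a b) + (\<gamma> c d + \<epsilon> * \<delta> c d)
        - (\<gamma> (a + c) (b + d) + \<epsilon> * \<delta> (a + c) (b + d)))\<^sup>2) = (\<lambda>s. (p s + \<epsilon> * q s)\<^sup>2)"
      by (auto simp: fun_eq_iff p_def q_def algebra_simps)
    ultimately show ?thesis by simp
  qed
  have pp: "((\<lambda>s. (p s)\<^sup>2) has_sum 2 * A) ?S"
    using area_g_triangle[OF assms(1,3)] by (simp add: p_def A_def case_prod_unfold)
  have qq: "((\<lambda>s. (q s)\<^sup>2) has_sum 2 * B) ?S"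
    using area_g_triangle[OF assms(2,4)] by (simp add: q_def B_def case_prod_unfold)
  \<comment> \<open>Polarization of the area formula at \<open>\<epsilon> = 1\<close> shows that the mixed sum converges.\<close>
  obtain y0 y1 g where "triangle_sum x0 x1 g1 x0' x1' g2 1 y0 y1 g"
    using triangle_sum_exists[OF assms(1,2), of 1] by auto
  note sum1 = sum_area[OF this zero_less_one]
  \<comment> \<open>Half of the sum of \<open>(p + q)^2 - p^2 - q^2\<close>, spelled out with
    explicit factors to match the termwise rules for \<open>has_sum\<close>.\<close>
  define M where "M = 1 / 2 * (2 * measure lborel (g_triangle y0 y1 g)) + - (1 / 2) * (2 * A) + - (1 / 2) * (2 * B)"
  have "((\<lambda>s. 1 / 2 * (p s + 1 * q s)\<^sup>2 + - (1 / 2) * (p s)\<^sup>2 + - (1 / 2) * (q s)\<^sup>2) has_sum M) ?S"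
    unfolding M_def by (intro has_sum_add has_sum_cmult_right pp qq sum1)
  moreover have "(\<lambda>s. 1 / 2 * (p s + 1 * q s)\<^sup>2 + - (1 / 2) * (p s)\<^sup>2 + - (1 / 2) * (q s)\<^sup>2) = (\<lambda>s. p s * q s)"
    by (simp add: fun_eq_iff power2_eq_square field_simps)
  ultimately have M: "((\<lambda>s. p s * q s) has_sum M) ?S" by simp
  have "has_mixed_area x0 x1 g1 x0' x1' g2 M"
    unfolding has_mixed_area_def
  \<comment> \<open>Half of
    \<open>2 * A + 2 * \<epsilon> * M + \<epsilon>\<^sup>2 * (2 * B)\<close>: the 2 of the area
    formula cancels the 2 of the cross term, so the linear coefficient is \<open>M\<close>
    itself.\<close>
  proof (intro exI[of _ "[:A, M, B:]"] conjI allI impI)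
    fix \<epsilon> :: real assume "\<epsilon> > 0"
    then obtain y0 y1 g where sum: "triangle_sum x0 x1 g1 x0' x1' g2 \<epsilon> y0 y1 g"
      using triangle_sum_exists[OF assms(1,2)] by blast
    have "((\<lambda>s. (p s)\<^sup>2 + 2 * \<epsilon> * (p s * q s) + \<epsilon>\<^sup>2 * (q s)\<^sup>2)
        has_sum 2 * A + 2 * \<epsilon> * M + \<epsilon>\<^sup>2 * (2 * B)) ?S"
      by (intro has_sum_add has_sum_cmult_right pp qq M)
    moreover have "(\<lambda>s. (p s)\<^sup>2 + 2 * \<epsilon> * (p s * q s) + \<epsilon>\<^sup>2 * (q s)\<^sup>2) = (\<lambda>s. (p s + \<epsilon> * q s)\<^sup>2)"
      by (simp add: fun_eq_iff power2_eq_square algebra_simps)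
    ultimately have "2 * measure lborel (g_triangle y0 y1 g) = 2 * A + 2 * \<epsilon> * M + \<epsilon>\<^sup>2 * (2 * B)"
      using has_sum_unique[OF sum_area[OF sum \<open>\<epsilon> > 0\<close>]] by simp
    then have "measure lborel (g_triangle y0 y1 g) = poly [:A, M, B:] \<epsilon>"
      by (simp add: power2_eq_square algebra_simps)
    with sum show "\<exists>y0 y1 g. triangle_sum x0 x1 g1 x0' x1' g2 \<epsilon> y0 y1 g \<and>
        measure lborel (g_triangle y0 y1 g) = poly [:A, M, B:] \<epsilon>" by blast
  qed simp
  moreover have "(\<lambda>(a, b, c, d). (\<gamma> a b + \<gamma> c d - \<gamma> (a + c) (b + d)) * (\<delta> a b + \<delta> c d - \<delta> (a + c) (b + d)))
      = (\<lambda>s. p s * q s)"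
    by (auto simp: fun_eq_iff p_def q_def)
  ultimately show ?thesis using M by auto
qed

end
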